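(* There exists a recursive coloring function $c:\mathbb{N}\rightarrow \{0,1\}^3$ such that no infinite $\Pi^0_3$ set $A\subseteq\mathbb{N}$ is a solution to $c$ for Hindman's theorem, i.e. for every infinite $\Pi^0_3$ set $A$, the set $FS(A)$ is not monochromatic under $c$.
   Context: For a set $H\subseteq\mathbb{N}$, $FS(H)=\{\sum_{x\in F}x : F\subseteq H,\ F \text{ finite and nonempty}\}$. A set $H$ is a solution to a coloring $c$ for Hindman's theorem if $H$ is infinite and $FS(H)$ is monochromatic under $c$. *)

theory Defs
  imports Main
begin

text \<open>Codes of (partial) mu-recursive functions, Kleene style.
  Arguments are passed as a list; Id i projects the i-th argument,
  Pr recurses on the first argument, Mn minimises over the first argument.\<close>

datatype recf = Z | S | Id nat | Cn recf "recf list" | Pr recf recf | Mn recf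

inductive rec_eval :: "recf \<Rightarrow> nat list \<Rightarrow> nat \<Rightarrow> bool" where
  rZ: "rec_eval Z xs 0"
| rS: "rec_eval S (x # xs) (Suc x)"
| rId: "i < length xs \<Longrightarrow> rec_eval (Id i) xs (xs ! i)"
| rCn: "list_all2 (\<lambda>g y. rec_eval g xs y) gs ys \<Longrightarrow> rec_eval f ys y \<Longrightarrow> rec_eval (Cn f gs) xs y"
| rPr0: "rec_eval f xs y \<Longrightarrow> rec_eval (Pr f g) (0 # xs) y"
| rPrS: "rec_eval (Pr f g) (n # xs) y \<Longrightarrow> rec_eval g (n # y # xs) z
          \<Longrightarrow> rec_eval (Pr f g) (Suc n # xs) z"
| rMn: "rec_eval f (n # xs) 0 \<Longrightarrow> (\<forall>m<n. \<exists>v. rec_eval f (m # xs) v \<and> 0 < v)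
          \<Longrightarrow> rec_eval (Mn f) xs n"

definition recursive1 :: "(nat \<Rightarrow> nat) \<Rightarrow> bool" where
  "recursive1 f \<longleftrightarrow> (\<exists>p. \<forall>n. rec_eval p [n] (f n))"

definition recursive_rel4 :: "(nat \<Rightarrow> nat \<Rightarrow> nat \<Rightarrow> nat \<Rightarrow> bool) \<Rightarrow> bool" where
  "recursive_rel4 R \<longleftrightarrow>
     (\<exists>p. \<forall>a b c d. rec_eval p [a, b, c, d] (if R a b c d then 1 else 0))"

definition Pi03 :: "nat set \<Rightarrow> bool" where
  "Pi03 A \<longleftrightarrow> (\<exists>R. recursive_rel4 R \<and> (\<forall>n. n \<in> A \<longleftrightarrow> (\<forall>x. \<exists>y. \<forall>z. R n x y z)))"

definition FS :: "nat set \<Rightarrow> nat set" where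
  "FS H = {\<Sum>F | F. F \<subseteq> H \<and> finite F \<and> F \<noteq> {}}"

definition hindman_solution :: "(nat \<Rightarrow> nat) \<Rightarrow> nat set \<Rightarrow> bool" where
  "hindman_solution c H \<longleftrightarrow> infinite H \<and> (\<exists>k. \<forall>x\<in>FS H. c x = k)"

end

theory Submission
  imports Defs "HOL-Library.Nat_Bijection" "HOL-Library.Infinite_Set"
begin

text \<open>
  One bit of colour suffices. Write \<open>x\<close> in binary and put
  \<open>c(x) = \<Sum> T\<^sub>t(x mod 2^t)\<close> modulo 2, the sum running over the set bits \<open>t\<close> of \<open>x\<close>, where \<open>T\<^sub>t(y)\<close> is a
  quadratic form in the bits of \<open>y\<close> below its top bit \<open>a\<close>, with coefficients \<open>D t a p' p \<in> {0, 1}\<close>.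

  Let \<open>A\<close> be a solution of colour \<open>\<gamma>\<close>, let \<open>m, m', m'', k\<close> be sums of disjoint finite subsets of \<open>A\<close> whose
  binary supports are stacked in this order, and let \<open>\<tau>\<close> be the lowest bit of \<open>k\<close>. Adding up \<open>c(x + k)\<close> over the
  cube \<open>x \<in> {0, m} + {0, m'} + {0, m''}\<close>, the contributions of all bits of \<open>k\<close> above \<open>\<tau>\<close> cancel modulo 2, because
  third differences of quadratic forms vanish modulo 2. What is left is a relation between \<open>\<gamma>\<close>, the values of \<open>T\<^sub>\<tau>\<close>
  at \<open>m\<close>, \<open>m'\<close>, \<open>m + m'\<close> and the sum of \<open>D \<tau> a q' q\<close> over the bits \<open>q'\<close> of \<open>m'\<close> and \<open>q\<close> of \<open>m\<close>, where \<open>a\<close> is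
  the top bit of \<open>m''\<close>. It can be violated by the choice of the single entry \<open>D \<tau> a p' p\<close>, with \<open>p\<close> and \<open>p'\<close> the top
  bits of \<open>m\<close> and \<open>m'\<close>, all other entries that occur coming earlier in the lexicographic order.

  So \<open>D t a p' p\<close> is spent on one pair \<open>(m, m')\<close>, guessed from \<open>p, p', a, t\<close>. Membership in a \<open>\<Pi>\<^sup>0\<^sub>3\<close> set is a
  threefold limit of computable guesses, and the nested limit \<open>t\<close>, then \<open>a\<close>, then \<open>p'\<close> is exactly what the stacking
  of the four sums provides. Counting the positions claimed by smaller indices gives each pair of a \<open>\<Pi>\<^sup>0\<^sub>3\<close> index and a colour
  a position \<open>p\<close> of its own.\<close>

section \<open>Computable functions of finitely many variables\<close>

text \<open>An environment \<open>\<sigma>\<close> supplies the values of all variables. A program for \<open>f\<close> may read any long enough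
  initial segment of it, so that variables can be added and renamed freely.\<close>

definition computable :: "((nat \<Rightarrow> nat) \<Rightarrow> nat) \<Rightarrow> bool" where
  "computable f \<longleftrightarrow> (\<exists>p N. \<forall>\<sigma> n. N \<le> n \<longrightarrow> rec_eval p (map \<sigma> [0..<n]) (f \<sigma>))"

definition decidable :: "((nat \<Rightarrow> nat) \<Rightarrow> bool) \<Rightarrow> bool" where
  "decidable P \<longleftrightarrow> computable (\<lambda>\<sigma>. if P \<sigma> then 1 else 0)"

text \<open>\<open>case_nat i \<sigma>\<close> pushes a new variable in front of the environment. On
  argument lists this is the \<open>Cons\<close> that \<open>Pr\<close> puts before its
  parameters.\<close>

lemma map_case_nat_upt: "map (case_nat i \<sigma>) [0..<Suc n] = i # map \<sigma> [0..<n]"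
  by (subst upt_conv_Cons) (auto simp: map_Suc_upt[symmetric] comp_def simp del: map_Suc_upt upt_Suc)

lemma rcI: "(\<And>\<sigma> n. N \<le> n \<Longrightarrow> rec_eval p (map \<sigma> [0..<n]) (f \<sigma>)) \<Longrightarrow> computable f"
  unfolding computable_def by blast

lemma computable_var: "computable (\<lambda>\<sigma>. \<sigma> i)"
proof (rule rcI[where N = "Suc i" and p = "Id i"])
  fix \<sigma> :: "nat \<Rightarrow> nat" and n assume "Suc i \<le> n"
  then show "rec_eval (Id i) (map \<sigma> [0..<n]) (\<sigma> i)"
    using rec_eval.rId[of i "map \<sigma> [0..<n]"] by simp
qed

text \<open>The program for \<open>f\<close> may expect more than \<open>k\<close> arguments, so it
  is fed \<open>N + k\<close> of them, the surplus ones being zeros. The locality assumption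
  \<open>loc\<close> makes this padding harmless.\<close>

lemma computable_subst:
  assumes "computable f" and args: "\<And>i. i < k \<Longrightarrow> computable (\<lambda>\<sigma>. g i \<sigma>)"
    and loc: "\<And>\<sigma> \<tau>. (\<And>i. i < k \<Longrightarrow> \<sigma> i = \<tau> i) \<Longrightarrow> f \<sigma> = f \<tau>"
  shows "computable (\<lambda>\<sigma>. f (\<lambda>i. g i \<sigma>))"
proof -
  obtain p N where p: "\<And>\<sigma> n. N \<le> n \<Longrightarrow> rec_eval p (map \<sigma> [0..<n]) (f \<sigma>)"
    using assms(1) unfolding computable_def by blast
  have "\<forall>i. \<exists>q M. i < k \<longrightarrow> (\<forall>\<sigma> n. M \<le> n \<longrightarrow> rec_eval q (map \<sigma> [0..<n]) (g i \<sigma>))"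
    using args unfolding computable_def by blast
  then obtain q M where q:
    "\<And>i \<sigma> n. i < k \<Longrightarrow> M i \<le> n \<Longrightarrow> rec_eval (q i) (map \<sigma> [0..<n]) (g i \<sigma>)"
    by metis
  define K where "K = (\<Sum>i<k. M i)"
  have MK: "M i \<le> K" if "i < k" for i
    unfolding K_def using that by (intro member_le_sum) auto
  define gs where "gs = map (\<lambda>i. if i < k then q i else Z) [0..<N + k]"
  show ?thesis
  proof (rule rcI[where N = K and p = "Cn p gs"])
    fix \<sigma> :: "nat \<Rightarrow> nat" and n assume n: "K \<le> n"
    let ?\<tau> = "\<lambda>i. if i < k then g i \<sigma> else 0"
    have "list_all2 (\<lambda>h y. rec_eval h (map \<sigma> [0..<n]) y) gs (map ?\<tau> [0..<N + k])"
      unfolding gs_def list_all2_conv_all_nth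
      using q order_trans[OF MK n] by (auto intro: rec_eval.rZ)
    moreover have "rec_eval p (map ?\<tau> [0..<N + k]) (f ?\<tau>)"
      by (rule p) simp
    moreover have "f ?\<tau> = f (\<lambda>i. g i \<sigma>)"
      by (rule loc) simp
    ultimately show "rec_eval (Cn p gs) (map \<sigma> [0..<n]) (f (\<lambda>i. g i \<sigma>))"
      using rec_eval.rCn by metis
  qed
qed

text \<open>Projections rename every variable that the program reads. Under binders this makes room
  for an accumulator or a further bound variable next to variable 0.\<close>

lemma computable_reindex:
  assumes "computable f"
  shows "computable (\<lambda>\<tau>. f (\<lambda>i. \<tau> (\<rho> i)))"
proof -
  obtain p N where p: "\<And>\<sigma> n. N \<le> n \<Longrightarrow> rec_eval p (map \<sigma> [0..<n]) (f \<sigma>)"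
    using assms unfolding computable_def by blast
  show ?thesis
  proof (rule rcI[where N = "Suc (\<Sum>i<N. \<rho> i)" and p = "Cn p (map (\<lambda>i. Id (\<rho> i)) [0..<N])"])
    fix \<sigma> :: "nat \<Rightarrow> nat" and n assume n: "Suc (\<Sum>i<N. \<rho> i) \<le> n"
    have "rec_eval (Id (\<rho> i)) (map \<sigma> [0..<n]) (\<sigma> (\<rho> i))" if "i < N" for i
    proof -
      have "\<rho> i \<le> (\<Sum>i<N. \<rho> i)" using that by (intro member_le_sum) auto
      then show ?thesis using n rec_eval.rId[of "\<rho> i" "map \<sigma> [0..<n]"] by simp
    qed
    then have "list_all2 (\<lambda>g y. rec_eval g (map \<sigma> [0..<n]) y)
        (map (\<lambda>i. Id (\<rho> i)) [0..<N]) (map (\<lambda>i. \<sigma> (\<rho> i)) [0..<N])"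
      by (auto simp: list_all2_conv_all_nth)
    then show "rec_eval (Cn p (map (\<lambda>i. Id (\<rho> i)) [0..<N])) (map \<sigma> [0..<n]) (f (\<lambda>i. \<sigma> (\<rho> i)))"
      using p[of N "\<lambda>i. \<sigma> (\<rho> i)"] by (intro rec_eval.rCn) auto
  qed
qed

lemma computable_app1:
  assumes "computable (\<lambda>\<sigma>. F (\<sigma> 0))" "computable a"
  shows "computable (\<lambda>\<sigma>. F (a \<sigma>))"
proof -
  let ?g = "\<lambda>i. a"
  have g: "computable (?g i)" for i using assms(2-) by simp
  show ?thesis
    using computable_subst[where k = 1 and g = ?g, OF assms(1) g] by simp
qed

lemma computable_app2:
  assumes "computable (\<lambda>\<sigma>. F (\<sigma> 0) (\<sigma> 1))" "computable a" "computable b"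
  shows "computable (\<lambda>\<sigma>. F (a \<sigma>) (b \<sigma>))"
proof -
  let ?g = "\<lambda>i. if i = 0 then a else b"
  have g: "computable (?g i)" for i using assms(2-) by simp
  show ?thesis
    using computable_subst[where k = 2 and g = ?g, OF assms(1) g] by simp
qed

lemma computable_app3:
  assumes "computable (\<lambda>\<sigma>. F (\<sigma> 0) (\<sigma> 1) (\<sigma> 2))" "computable a" "computable b" "computable c"
  shows "computable (\<lambda>\<sigma>. F (a \<sigma>) (b \<sigma>) (c \<sigma>))"
proof -
  let ?g = "\<lambda>i. if i = 0 then a else if i = 1 then b else c"
  have g: "computable (?g i)" for i using assms(2-) by simp
  show ?thesis
    using computable_subst[where k = 3 and g = ?g, OF assms(1) g] by simp
qed

lemma computable_app4:
  assumes "computable (\<lambda>\<sigma>. F (\<sigma> 0) (\<sigma> 1) (\<sigma> 2) (\<sigma> 3))" "computable a" "computable b" "computable c" "computable d"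
  shows "computable (\<lambda>\<sigma>. F (a \<sigma>) (b \<sigma>) (c \<sigma>) (d \<sigma>))"
proof -
  let ?g = "\<lambda>i. if i = 0 then a else if i = 1 then b else if i = 2 then c else d"
  have g: "computable (?g i)" for i using assms(2-) by simp
  show ?thesis
    using computable_subst[where k = 4 and g = ?g, OF assms(1) g] by simp
qed

lemma computable_app5:
  assumes "computable (\<lambda>\<sigma>. F (\<sigma> 0) (\<sigma> 1) (\<sigma> 2) (\<sigma> 3) (\<sigma> 4))" "computable a" "computable b" "computable c" "computable d"
    "computable e"
  shows "computable (\<lambda>\<sigma>. F (a \<sigma>) (b \<sigma>) (c \<sigma>) (d \<sigma>) (e \<sigma>))"
proof -
  let ?g = "\<lambda>i. if i = 0 then a else if i = 1 then b else if i = 2 then c else if i = 3 then d else e"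
  have g: "computable (?g i)" for i using assms(2-) by simp
  show ?thesis
    using computable_subst[where k = 5 and g = ?g, OF assms(1) g] by simp
qed

section \<open>Primitive recursion and arithmetic\<close>

lemma computable_Suc_var: "computable (\<lambda>\<sigma>. Suc (\<sigma> 0))"
proof (rule rcI[where N = 1 and p = S])
  fix \<sigma> :: "nat \<Rightarrow> nat" and n :: nat assume "1 \<le> n"
  then have "[0..<n] = 0 # [Suc 0..<n]" by (simp add: upt_conv_Cons)
  then show "rec_eval S (map \<sigma> [0..<n]) (Suc (\<sigma> 0))"
    by (simp add: rec_eval.rS)
qed

lemma computable_Suc: "computable a \<Longrightarrow> computable (\<lambda>\<sigma>. Suc (a \<sigma>))"
  by (rule computable_app1[OF computable_Suc_var])

lemma computable_0: "computable (\<lambda>\<sigma>. 0)"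
  by (rule rcI[where N = 0 and p = Z]) (rule rec_eval.rZ)

lemma computable_const: "computable (\<lambda>\<sigma>. c)"
  by (induction c) (simp_all add: computable_0 computable_Suc)

text \<open>Variables 0 and 1 of the step function are the counter and the accumulator, in the order
  in which \<open>Pr\<close> passes them. The first \<open>K\<close> values of the environment are
  carried along as parameters, enough for both programs.\<close>

lemma computable_rec_nat:
  assumes "computable g" "computable (\<lambda>\<tau>. h (\<tau> 0) (\<tau> 1) (\<lambda>j. \<tau> (Suc (Suc j))))" "computable k"
  shows "computable (\<lambda>\<sigma>. rec_nat (g \<sigma>) (\<lambda>i acc. h i acc \<sigma>) (k \<sigma>))"
proof -
  obtain p N where p: "\<And>\<sigma> n. N \<le> n \<Longrightarrow> rec_eval p (map \<sigma> [0..<n]) (g \<sigma>)"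
    using assms(1) unfolding computable_def by blast
  obtain q M where q: "\<And>\<sigma> n. M \<le> n \<Longrightarrow> rec_eval q (map \<sigma> [0..<n]) (h (\<sigma> 0) (\<sigma> 1) (\<lambda>j. \<sigma> (Suc (Suc j))))"
    using assms(2) unfolding computable_def by blast
  obtain r L where r: "\<And>\<sigma> n. L \<le> n \<Longrightarrow> rec_eval r (map \<sigma> [0..<n]) (k \<sigma>)"
    using assms(3) unfolding computable_def by blast
  define K where "K = N + M"
  have pr: "rec_eval (Pr p q) (i # map \<sigma> [0..<K]) (rec_nat (g \<sigma>) (\<lambda>i acc. h i acc \<sigma>) i)" for i \<sigma>
  proof (induction i)
    case 0
    show ?case using p[of K \<sigma>] by (auto simp: K_def intro: rec_eval.rPr0)
  next
    case (Suc i)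
    let ?acc = "rec_nat (g \<sigma>) (\<lambda>i acc. h i acc \<sigma>) i"
    have "rec_eval q (map (case_nat i (case_nat ?acc \<sigma>)) [0..<Suc (Suc K)]) (h i ?acc \<sigma>)"
      using q[of "Suc (Suc K)" "case_nat i (case_nat ?acc \<sigma>)"] by (simp add: K_def del: upt_Suc)
    then have "rec_eval q (i # ?acc # map \<sigma> [0..<K]) (h i ?acc \<sigma>)"
      by (simp only: map_case_nat_upt)
    then show ?case using rec_eval.rPrS[OF Suc.IH] by simp
  qed
  show ?thesis
  proof (rule rcI[where N = "L + K" and p = "Cn (Pr p q) (r # map Id [0..<K])"])
    fix \<sigma> :: "nat \<Rightarrow> nat" and n assume n: "L + K \<le> n"
    have "list_all2 (\<lambda>g y. rec_eval g (map \<sigma> [0..<n]) y) (map Id [0..<K]) (map \<sigma> [0..<K])"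
      unfolding list_all2_conv_all_nth
    proof (intro conjI allI impI)
      fix i assume "i < length (map Id [0..<K])"
      then have "i < K" "i < n" using n by auto
      then show "rec_eval (map Id [0..<K] ! i) (map \<sigma> [0..<n]) (map \<sigma> [0..<K] ! i)"
        using rec_eval.rId[of i "map \<sigma> [0..<n]"] by simp
    qed simp
    then have "list_all2 (\<lambda>g y. rec_eval g (map \<sigma> [0..<n]) y) (r # map Id [0..<K]) (k \<sigma> # map \<sigma> [0..<K])"
      using r n by simp
    then show "rec_eval (Cn (Pr p q) (r # map Id [0..<K])) (map \<sigma> [0..<n])
        (rec_nat (g \<sigma>) (\<lambda>i acc. h i acc \<sigma>) (k \<sigma>))"
      using pr by (rule rec_eval.rCn)
  qed
qed

lemma computable_add: "computable a \<Longrightarrow> computable b \<Longrightarrow> computable (\<lambda>\<sigma>. a \<sigma> + b \<sigma>)"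
proof (rule computable_app2[where F = "(+)"])
  have "rec_nat b (\<lambda>i acc. Suc acc) a = a + b" for a b :: nat by (induction a) auto
  then show "computable (\<lambda>\<sigma>. \<sigma> 0 + \<sigma> 1)"
    using computable_rec_nat[where g = "\<lambda>\<sigma>. \<sigma> 1" and h = "\<lambda>i acc \<sigma>. Suc acc" and k = "\<lambda>\<sigma>. \<sigma> 0"]
    by (simp add: computable_var computable_Suc)
qed

lemma computable_mult: "computable a \<Longrightarrow> computable b \<Longrightarrow> computable (\<lambda>\<sigma>. a \<sigma> * b \<sigma>)"
proof (rule computable_app2[where F = "(*)"])
  have "rec_nat 0 (\<lambda>i acc. acc + b) a = a * b" for a b :: nat by (induction a) auto
  then show "computable (\<lambda>\<sigma>. \<sigma> 0 * \<sigma> 1)"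
    using computable_rec_nat[where g = "\<lambda>\<sigma>. 0" and h = "\<lambda>i acc \<sigma>. acc + \<sigma> 1" and k = "\<lambda>\<sigma>. \<sigma> 0"]
    by (simp add: computable_var computable_add computable_0)
qed

lemma computable_diff: "computable a \<Longrightarrow> computable b \<Longrightarrow> computable (\<lambda>\<sigma>. a \<sigma> - b \<sigma>)"
proof (rule computable_app2[where F = "(-)"])
  have "rec_nat 0 (\<lambda>i acc. i) a = a - 1" for a :: nat by (cases a) auto
  then have pred: "computable (\<lambda>\<sigma>. \<sigma> 0 - 1)"
    using computable_rec_nat[where g = "\<lambda>\<sigma>. 0" and h = "\<lambda>i acc \<sigma>. i" and k = "\<lambda>\<sigma>. \<sigma> 0"]
    by (simp add: computable_var computable_0)
  have "rec_nat a (\<lambda>i acc. acc - 1) b = a - b" for a b :: nat by (induction b) auto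
  then show "computable (\<lambda>\<sigma>. \<sigma> 0 - \<sigma> 1)"
    using computable_rec_nat[where g = "\<lambda>\<sigma>. \<sigma> 0" and h = "\<lambda>i acc \<sigma>. acc - 1" and k = "\<lambda>\<sigma>. \<sigma> 1"]
      computable_app1[OF pred, of "\<lambda>\<tau>. \<tau> 1"]
    by (simp add: computable_var)
qed

lemma computable_power: "computable a \<Longrightarrow> computable b \<Longrightarrow> computable (\<lambda>\<sigma>. a \<sigma> ^ b \<sigma>)"
proof (rule computable_app2[where F = "(^)"])
  have "rec_nat 1 (\<lambda>i acc. acc * a) b = a ^ b" for a b :: nat by (induction b) auto
  then show "computable (\<lambda>\<sigma>. \<sigma> 0 ^ \<sigma> 1)"
    using computable_rec_nat[where g = "\<lambda>\<sigma>. 1" and h = "\<lambda>i acc \<sigma>. acc * \<sigma> 0" and k = "\<lambda>\<sigma>. \<sigma> 1"]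
    by (simp add: computable_var computable_mult computable_const)
qed

section \<open>Case distinctions, decidable predicates and bounded quantifiers\<close>

lemma computable_If: "decidable P \<Longrightarrow> computable a \<Longrightarrow> computable b \<Longrightarrow> computable (\<lambda>\<sigma>. if P \<sigma> then a \<sigma> else b \<sigma>)"
proof -
  assume "decidable P" "computable a" "computable b"
  then have "computable (\<lambda>\<sigma>. (if P \<sigma> then 1 else 0) * a \<sigma> + (1 - (if P \<sigma> then 1 else 0)) * b \<sigma>)"
    unfolding decidable_def by (intro computable_add computable_mult computable_diff computable_const)
  then show ?thesis by (rule back_subst[of computable]) auto
qed

lemma decidable_le: "computable a \<Longrightarrow> computable b \<Longrightarrow> decidable (\<lambda>\<sigma>. a \<sigma> \<le> b \<sigma>)"
proof -
  assume "computable a" "computable b"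
  then have "computable (\<lambda>\<sigma>. 1 - (a \<sigma> - b \<sigma>))" by (intro computable_diff computable_const)
  then show ?thesis unfolding decidable_def by (rule back_subst[of computable]) auto
qed

lemma decidable_not: "decidable P \<Longrightarrow> decidable (\<lambda>\<sigma>. \<not> P \<sigma>)"
proof -
  assume "decidable P"
  then have "computable (\<lambda>\<sigma>. 1 - (if P \<sigma> then 1 else 0))" unfolding decidable_def by (intro computable_diff computable_const)
  then show ?thesis unfolding decidable_def by (rule back_subst[of computable]) auto
qed

lemma decidable_conj: "decidable P \<Longrightarrow> decidable Q \<Longrightarrow> decidable (\<lambda>\<sigma>. P \<sigma> \<and> Q \<sigma>)"
proof -
  assume "decidable P" "decidable Q"
  then have "computable (\<lambda>\<sigma>. (if P \<sigma> then 1 else 0) * (if Q \<sigma> then 1 else 0))"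
    unfolding decidable_def by (intro computable_mult)
  then show ?thesis unfolding decidable_def by (rule back_subst[of computable]) auto
qed

lemma decidable_disj:
  assumes "decidable P" "decidable Q"
  shows "decidable (\<lambda>\<sigma>. P \<sigma> \<or> Q \<sigma>)"
  using decidable_not[OF decidable_conj[OF decidable_not[OF assms(1)] decidable_not[OF assms(2)]]] by simp

lemma decidable_imp:
  assumes "decidable P" "decidable Q"
  shows "decidable (\<lambda>\<sigma>. P \<sigma> \<longrightarrow> Q \<sigma>)"
  using decidable_disj[OF decidable_not[OF assms(1)] assms(2)] by (simp only: imp_conv_disj)

lemma decidable_less:
  assumes "computable a" "computable b"
  shows "decidable (\<lambda>\<sigma>. a \<sigma> < b \<sigma>)"
  using decidable_not[OF decidable_le[OF assms(2,1)]] by (simp add: not_le)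

lemma decidable_eq:
  assumes "computable a" "computable b"
  shows "decidable (\<lambda>\<sigma>. a \<sigma> = b \<sigma>)"
  using decidable_conj[OF decidable_le[OF assms] decidable_le[OF assms(2,1)]]
  by (rule back_subst[of decidable]) (auto simp: fun_eq_iff)

lemma decidable_iff:
  assumes "decidable P" "decidable Q"
  shows "decidable (\<lambda>\<sigma>. P \<sigma> \<longleftrightarrow> Q \<sigma>)"
  using decidable_conj[OF decidable_imp[OF assms] decidable_imp[OF assms(2,1)]]
  by (rule back_subst[of decidable]) (auto simp: fun_eq_iff)

lemma computable_of_bool: "decidable P \<Longrightarrow> computable (\<lambda>\<sigma>. of_bool (P \<sigma>))"
  unfolding decidable_def of_bool_def .

lemma computable_sum:
  assumes "computable (\<lambda>\<tau>. h (\<tau> 0) (\<lambda>j. \<tau> (Suc j)))" "computable k"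
  shows "computable (\<lambda>\<sigma>. \<Sum>i<k \<sigma>. h i \<sigma>)"
proof -
  have "computable (\<lambda>\<tau>. h (\<tau> 0) (\<lambda>j. \<tau> (Suc (Suc j))))"
    using computable_reindex[OF assms(1), where \<rho> = "case_nat 0 (\<lambda>j. Suc (Suc j))"] by simp
  then have *: "computable (\<lambda>\<tau>. \<tau> 1 + h (\<tau> 0) (\<lambda>j. \<tau> (Suc (Suc j))))"
    by (intro computable_add computable_var)
  have "rec_nat 0 (\<lambda>i acc. acc + h i \<sigma>) n = (\<Sum>i<n. h i \<sigma>)" for n \<sigma>
    by (induction n) auto
  then show ?thesis
    using computable_rec_nat[where g = "\<lambda>_. 0" and h = "\<lambda>i acc \<sigma>. acc + h i \<sigma>" and k = k] * assms(2)
    by (simp add: computable_0)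
qed

lemma decidable_bex:
  assumes "decidable (\<lambda>\<tau>. P (\<tau> 0) (\<lambda>j. \<tau> (Suc j)))" "computable k"
  shows "decidable (\<lambda>\<sigma>. \<exists>i<k \<sigma>. P i \<sigma>)"
proof -
  have "decidable (\<lambda>\<sigma>. 0 < (\<Sum>i<k \<sigma>. of_bool (P i \<sigma>) :: nat))"
    by (rule decidable_less[OF computable_0 computable_sum]) (use computable_of_bool[OF assms(1)] assms(2) in auto)
  then show ?thesis
    by (rule back_subst[of decidable]) (auto simp: fun_eq_iff card_gt_0_iff)
qed

lemma decidable_ball:
  assumes "decidable (\<lambda>\<tau>. P (\<tau> 0) (\<lambda>j. \<tau> (Suc j)))" "computable k"
  shows "decidable (\<lambda>\<sigma>. \<forall>i<k \<sigma>. P i \<sigma>)"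
  using decidable_not[OF decidable_bex[OF decidable_not[OF assms(1)] assms(2)]] by simp

lemma decidable_bex_le:
  assumes "decidable (\<lambda>\<tau>. P (\<tau> 0) (\<lambda>j. \<tau> (Suc j)))" "computable k"
  shows "decidable (\<lambda>\<sigma>. \<exists>i\<le>k \<sigma>. P i \<sigma>)"
  using decidable_bex[OF assms(1) computable_Suc[OF assms(2)]] by (simp add: less_Suc_eq_le)

lemma decidable_ball_le:
  assumes "decidable (\<lambda>\<tau>. P (\<tau> 0) (\<lambda>j. \<tau> (Suc j)))" "computable k"
  shows "decidable (\<lambda>\<sigma>. \<forall>i\<le>k \<sigma>. P i \<sigma>)"
  using decidable_ball[OF assms(1) computable_Suc[OF assms(2)]] by (simp add: less_Suc_eq_le)

text \<open>Least \<open>i < k\<close> with \<open>P i\<close>, and \<open>k\<close> if there is none.\<close>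

definition bleast :: "nat \<Rightarrow> (nat \<Rightarrow> bool) \<Rightarrow> nat" where
  "bleast k P = (\<Sum>i<k. of_bool (\<forall>j\<le>i. \<not> P j))"

lemma bleast_eqI:
  assumes "i < k" "P i" "\<And>j. j < i \<Longrightarrow> \<not> P j"
  shows "bleast k P = i"
proof -
  have "(\<forall>j\<le>l. \<not> P j) \<longleftrightarrow> l < i" for l
    using assms(2,3) by (meson leI le_less_trans)
  then have "bleast k P = card {l. l < k \<and> l < i}"
    unfolding bleast_def by (simp add: Int_def)
  also have "{l. l < k \<and> l < i} = {..<i}" using assms(1) by auto
  finally show ?thesis by simp
qed

lemma bleast_works:
  assumes "i < k" "P i"
  shows "bleast k P < k \<and> P (bleast k P)"
proof -
  let ?j = "LEAST i. P i"
  have "?j < k" using Least_le[of P i] assms by linarith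
  moreover have "P ?j" using assms(2) by (rule LeastI)
  moreover have "\<not> P j" if "j < ?j" for j using that by (rule not_less_Least)
  ultimately have "bleast k P = ?j" by (rule bleast_eqI)
  with \<open>?j < k\<close> \<open>P ?j\<close> show ?thesis by simp
qed

lemma computable_bleast:
  assumes "decidable (\<lambda>\<tau>. P (\<tau> 0) (\<lambda>j. \<tau> (Suc j)))" "computable k"
  shows "computable (\<lambda>\<sigma>. bleast (k \<sigma>) (\<lambda>i. P i \<sigma>))"
proof -
  have "decidable (\<lambda>\<tau>. \<forall>j\<le>\<tau> 0. \<not> P j (\<lambda>j. \<tau> (Suc j)))"
    using computable_reindex[OF assms(1)[unfolded decidable_def], where \<rho> = "case_nat 0 (\<lambda>j. Suc (Suc j))"]
    by (intro decidable_ball_le decidable_not computable_var) (simp add: decidable_def)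
  then show ?thesis unfolding bleast_def
    by (intro computable_sum computable_of_bool assms)
qed

lemma computable_div: "computable a \<Longrightarrow> computable b \<Longrightarrow> computable (\<lambda>\<sigma>. a \<sigma> div b \<sigma>)"
proof -
  assume ab: "computable a" "computable b"
  \<comment> \<open>A failing search returns its bound \<open>a\<close>. For \<open>b = 1\<close>
    this is the right quotient; \<open>b = 0\<close> is split off below because there the quotient
    is 0.\<close>
  have *: "bleast a (\<lambda>q. a < Suc q * b) = (if b = 0 then a else a div b)" for a b :: nat
  proof (cases "a = 0 \<or> b = 0")
    case True
    then show ?thesis by (auto simp: bleast_def)
  next
    case False
    show ?thesis
    proof (cases "b = 1")
      case True
      then show ?thesis by (auto simp: bleast_def)
    next
      case b: False
      have "a div b < a" using False b by simp
      moreover have "a < Suc (a div b) * b" using False dividend_less_div_times[of b a] by simp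
      moreover have "\<not> a < Suc q * b" if "q < a div b" for q
        using that False by (metis Suc_leI div_times_less_eq_dividend mult_le_mono1 not_le order_trans)
      ultimately show ?thesis using False bleast_eqI[of "a div b" a "\<lambda>q. a < Suc q * b"] by simp
    qed
  qed
  have "computable (\<lambda>\<sigma>. if \<sigma> 1 = 0 then 0 else bleast (\<sigma> 0) (\<lambda>q. \<sigma> 0 < Suc q * \<sigma> 1))"
    by (intro computable_If decidable_eq computable_bleast decidable_less computable_mult computable_Suc computable_var computable_const)
  then have "computable (\<lambda>\<sigma>. \<sigma> 0 div \<sigma> 1)"
    by (rule back_subst[of computable]) (simp add: fun_eq_iff * del: mult_Suc)
  then show ?thesis by (rule computable_app2[OF _ ab])
qed

lemma computable_mod: "computable a \<Longrightarrow> computable b \<Longrightarrow> computable (\<lambda>\<sigma>. a \<sigma> mod b \<sigma>)"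
  by (subst modulo_nat_def) (intro computable_diff computable_mult computable_div)

lemma decidable_dvd: "computable a \<Longrightarrow> computable b \<Longrightarrow> decidable (\<lambda>\<sigma>. a \<sigma> dvd b \<sigma>)"
  by (subst dvd_eq_mod_eq_0) (intro decidable_eq computable_mod computable_const)

lemmas computable_intros = computable_var computable_const computable_Suc computable_add computable_mult
  computable_diff computable_power computable_div computable_mod computable_If computable_of_bool
  computable_sum computable_bleast decidable_le decidable_less decidable_eq decidable_not decidable_conj
  decidable_disj decidable_imp decidable_iff decidable_bex decidable_ball decidable_bex_le decidable_ball_le
  decidable_dvd

text \<open>The program may read \<open>N\<close> further arguments; zeros are supplied for them,
  since the value depends on variable 0 alone.\<close>

lemma recursive1I:
  assumes "computable (\<lambda>\<sigma>. f (\<sigma> 0))"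
  shows "recursive1 f"
proof -
  obtain p N where p: "\<And>\<sigma> n. N \<le> n \<Longrightarrow> rec_eval p (map \<sigma> [0..<n]) (f (\<sigma> 0))"
    using assms unfolding computable_def by blast
  have "rec_eval (Cn p (Id 0 # replicate N Z)) [n] (f n)" for n
  proof (rule rec_eval.rCn)
    show "list_all2 (\<lambda>g y. rec_eval g [n] y) (Id 0 # replicate N Z) (map (case_nat n (\<lambda>_. 0)) [0..<Suc N])"
      using rec_eval.rId[of 0 "[n]"] unfolding map_case_nat_upt
      by (simp add: list_all2_conv_all_nth[of _ "replicate N Z"] rec_eval.rZ)
    show "rec_eval p (map (case_nat n (\<lambda>_. 0)) [0..<Suc N]) (f n)"
      using p[of "Suc N" "case_nat n (\<lambda>_. 0)"] by (simp del: upt_Suc)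
  qed
  then show ?thesis unfolding recursive1_def by blast
qed

section \<open>Coding evaluation derivations\<close>

text \<open>Ensures that a derivation of the value 0 excludes the value 1, so that derivations can
  refute a recursive relation.\<close>

lemma rec_eval_det: "rec_eval p xs y \<Longrightarrow> rec_eval p xs y' \<Longrightarrow> y' = y"
proof (induction arbitrary: y' rule: rec_eval.induct)
  case (rZ xs)
  then show ?case by (auto elim: rec_eval.cases)
next
  case (rS x xs)
  then show ?case by (auto elim: rec_eval.cases)
next
  case (rId i xs)
  from rId(2) show ?case by (auto elim: rec_eval.cases)
next
  case (rCn xs gs ys f y)
  from rCn.prems obtain zs where zs: "list_all2 (\<lambda>g y. rec_eval g xs y) gs zs" "rec_eval f zs y'"
    by (auto elim: rec_eval.cases)
  have "zs = ys"
    using rCn.IH(1) zs(1) by (auto simp: list_all2_conv_all_nth intro!: nth_equalityI)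
  with rCn.IH(2) zs(2) show ?case by simp
next
  case (rPr0 f xs y g)
  from rPr0.prems have "rec_eval f xs y'" by (auto elim: rec_eval.cases)
  with rPr0.IH show ?case .
next
  case (rPrS f g n xs y z)
  from rPrS.prems obtain v where "rec_eval (Pr f g) (n # xs) v" "rec_eval g (n # v # xs) y'"
    by (auto elim: rec_eval.cases)
  with rPrS.IH show ?case by metis
next
  case (rMn f n xs)
  from rMn.prems have y': "rec_eval f (y' # xs) 0" "\<forall>m<y'. \<exists>v. rec_eval f (m # xs) v \<and> 0 < v"
    by (auto elim: rec_eval.cases)
  show ?case
  proof (rule linorder_cases[of y' n])
    assume "y' < n"
    then obtain v where "\<forall>w. rec_eval f (y' # xs) w \<longrightarrow> w = v" "0 < v" using rMn.IH(2) by blast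
    with y'(1) show ?case by fastforce
  next
    assume "n < y'"
    then obtain v where "rec_eval f (n # xs) v" "0 < v" using y'(2) by blast
    with rMn.IH(1) show ?case by fastforce
  qed
qed

section \<open>Numerical codes of programs and lists\<close>

fun enc :: "recf \<Rightarrow> nat" where
  "enc Z = prod_encode (0, 0)"
| "enc S = prod_encode (1, 0)"
| "enc (Id i) = prod_encode (2, i)"
| "enc (Cn f gs) = prod_encode (3, prod_encode (enc f, list_encode (map enc gs)))"
| "enc (Pr f g) = prod_encode (4, prod_encode (enc f, enc g))"
| "enc (Mn f) = prod_encode (5, enc f)"

definition triple :: "nat \<Rightarrow> nat \<Rightarrow> nat \<Rightarrow> nat" where
  "triple f xs y = prod_encode (f, prod_encode (xs, y))"

text \<open>Agrees with \<open>list_encode\<close> on nonempty lists; the successor keeps 0 free for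
  the empty list.\<close>

definition lcons :: "nat \<Rightarrow> nat \<Rightarrow> nat" where
  "lcons a r = Suc (prod_encode (a, r))"

definition lhd :: "nat \<Rightarrow> nat" where
  "lhd l = bleast (Suc l) (\<lambda>a. \<exists>r\<le>l. l = lcons a r)"

definition ltl :: "nat \<Rightarrow> nat" where
  "ltl l = (if l = 0 then 0 else bleast (Suc l) (\<lambda>r. \<exists>a\<le>l. l = lcons a r))"

definition ldrop :: "nat \<Rightarrow> nat \<Rightarrow> nat" where
  "ldrop n l = rec_nat l (\<lambda>_. ltl) n"

lemma lcons_eq_iff [simp]: "lcons a r = lcons b s \<longleftrightarrow> a = b \<and> r = s"
  by (simp add: lcons_def)

lemma lcons_gt: "a < lcons a r" "r < lcons a r"
  by (simp_all add: lcons_def less_Suc_eq_le le_prod_encode_1 le_prod_encode_2)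

lemma lhd_lcons [simp]: "lhd (lcons a r) = a"
  unfolding lhd_def by (rule bleast_eqI) (auto simp: less_imp_le lcons_gt less_SucI)

lemma ltl_lcons [simp]: "ltl (lcons a r) = r"
proof -
  have "bleast (Suc (lcons a r)) (\<lambda>s. \<exists>b\<le>lcons a r. lcons a r = lcons b s) = r"
    by (rule bleast_eqI) (auto simp: less_imp_le lcons_gt less_SucI)
  then show ?thesis by (simp add: ltl_def lcons_def)
qed

lemma list_encode_Cons [simp]: "list_encode (x # xs) = lcons x (list_encode xs)"
  by (simp add: lcons_def)

declare list_encode.simps(2) [simp del]

lemma lcons_pos [simp]: "0 < lcons a r" "lcons a r \<noteq> 0"
  by (simp_all add: lcons_def)

lemma ldrop_0 [simp]: "ldrop 0 l = l"
  by (simp add: ldrop_def)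

lemma ldrop_Suc_lcons [simp]: "ldrop (Suc n) (lcons a r) = ldrop n r"
  by (induction n) (simp_all add: ldrop_def)

lemma ldrop_list_encode: "ldrop n (list_encode xs) = list_encode (drop n xs)"
proof (induction n arbitrary: xs)
  case (Suc n)
  show ?case
  proof (cases xs)
    case Nil
    have "ldrop n 0 = 0" for n by (induction n) (simp_all add: ldrop_def ltl_def)
    then show ?thesis using Nil by simp
  qed (use Suc in simp)
qed simp

lemma ldrop_list_encode_lcons:
  "i < length xs \<Longrightarrow> ldrop i (list_encode xs) = lcons (xs ! i) (list_encode (drop (Suc i) xs))"
  by (simp add: ldrop_list_encode flip: list_encode_Cons Cons_nth_drop_Suc)

lemma list_encode_eq_0_iff: "list_encode xs = 0 \<longleftrightarrow> xs = []"
  by (cases xs) auto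

text \<open>A triple stands for the judgement that the program \<open>f\<close> maps the list \<open>xs\<close> to \<open>y\<close>.
  \<open>just M f xs y\<close> says that this judgement follows by one evaluation rule from judgements in \<open>M\<close>.\<close>

definition just :: "(nat \<Rightarrow> bool) \<Rightarrow> nat \<Rightarrow> nat \<Rightarrow> nat \<Rightarrow> bool" where
  "just M f xs y \<longleftrightarrow>
     f = prod_encode (0, 0) \<and> y = 0
   \<or> f = prod_encode (1, 0) \<and> (\<exists>a r. xs = lcons a r \<and> y = Suc a)
   \<or> (\<exists>i. f = prod_encode (2, i) \<and> ldrop i xs \<noteq> 0 \<and> y = lhd (ldrop i xs))
   \<or> (\<exists>g gs ys. f = prod_encode (3, prod_encode (g, gs)) \<and> M (triple g ys y) \<and>
        (\<forall>r. (ldrop r gs = 0 \<longleftrightarrow> ldrop r ys = 0) \<and>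
             (ldrop r gs \<noteq> 0 \<longrightarrow> M (triple (lhd (ldrop r gs)) xs (lhd (ldrop r ys))))))
   \<or> (\<exists>g h r. f = prod_encode (4, prod_encode (g, h)) \<and> xs = lcons 0 r \<and> M (triple g r y))
   \<or> (\<exists>g h r n v. f = prod_encode (4, prod_encode (g, h)) \<and> xs = lcons (Suc n) r \<and>
        M (triple f (lcons n r) v) \<and> M (triple h (lcons n (lcons v r)) y))
   \<or> (\<exists>g. f = prod_encode (5, g) \<and> M (triple g (lcons y xs) 0) \<and>
        (\<forall>m<y. \<exists>v. 0 < v \<and> M (triple g (lcons m xs) v)))"

definition closed_under_just :: "(nat \<Rightarrow> bool) \<Rightarrow> bool" where
  "closed_under_just M \<longleftrightarrow> (\<forall>f xs y. M (triple f xs y) \<longrightarrow> just M f xs y)"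

text \<open>Closure only asks that each judgement be supported inside \<open>M\<close>, which does
  not by itself exclude circular support. But every premise concerns a proper subprogram or, for
  \<open>Pr\<close>, the same program with a smaller counter, so induction on program and counter is
  enough.\<close>

lemma just_sound:
  assumes M: "closed_under_just M"
  shows "M (triple (enc p) (list_encode xs) y) \<Longrightarrow> rec_eval p xs y"
proof (induction p arbitrary: xs y)
  case Z
  then have "just M (enc Z) (list_encode xs) y" using M by (auto simp: closed_under_just_def)
  then show ?case by (auto simp: just_def intro: rec_eval.intros)
next
  case S
  then have "just M (enc S) (list_encode xs) y" using M by (auto simp: closed_under_just_def)
  then obtain a r where "list_encode xs = lcons a r" "y = Suc a" by (auto simp: just_def)
  then show ?case by (cases xs) (auto simp: lcons_def intro: rec_eval.intros)
next
  case (Id i)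
  then have "just M (enc (Id i)) (list_encode xs) y" using M by (auto simp: closed_under_just_def)
  then have "ldrop i (list_encode xs) \<noteq> 0" "y = lhd (ldrop i (list_encode xs))"
    by (auto simp: just_def)
  then have i: "i < length xs" and y: "y = lhd (list_encode (drop i xs))"
    by (auto simp: ldrop_list_encode list_encode_eq_0_iff)
  have "y = xs ! i" unfolding y Cons_nth_drop_Suc[OF i, symmetric] by simp
  with i show ?case by (auto intro: rec_eval.intros)
next
  case (Cn f gs)
  then have "just M (enc (Cn f gs)) (list_encode xs) y" using M by (auto simp: closed_under_just_def)
  then have "\<exists>ys. M (triple (enc f) ys y) \<and>
        (\<forall>r. (ldrop r (list_encode (map enc gs)) = 0 \<longleftrightarrow> ldrop r ys = 0) \<and>
             (ldrop r (list_encode (map enc gs)) \<noteq> 0 \<longrightarrow>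
                M (triple (lhd (ldrop r (list_encode (map enc gs)))) (list_encode xs) (lhd (ldrop r ys)))))"
    by (simp add: just_def)
  then obtain ysc where ys: "M (triple (enc f) ysc y)"
    "\<And>r. (ldrop r (list_encode (map enc gs)) = 0 \<longleftrightarrow> ldrop r ysc = 0)"
    "\<And>r. ldrop r (list_encode (map enc gs)) \<noteq> 0 \<Longrightarrow>
        M (triple (lhd (ldrop r (list_encode (map enc gs)))) (list_encode xs) (lhd (ldrop r ysc)))"
    by blast
  \<comment> \<open>Every number codes a list. That \<open>ldrop r\<close> vanishes for the same
    \<open>r\<close> on both codes forces equal lengths.\<close>
  define ys where "ys = list_decode ysc"
  have ysc: "ysc = list_encode ys" by (simp add: ys_def)
  have iff: "r < length gs \<longleftrightarrow> r < length ys" for r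
    using ys(2)[of r] unfolding ysc ldrop_list_encode list_encode_eq_0_iff by auto
  then have len: "length ys = length gs" by (metis linorder_neqE_nat less_irrefl)
  have "rec_eval (gs ! r) xs (ys ! r)" if r: "r < length gs" for r
  proof (rule Cn.IH(2))
    show "M (triple (enc (gs ! r)) (list_encode xs) (ys ! r))"
      using ys(3)[of r] r len by (simp add: ldrop_list_encode_lcons ysc)
  qed (use r in simp)
  moreover have "rec_eval f ys y" using Cn.IH(1) ys(1) by (simp add: ysc)
  ultimately show ?case using len by (intro rec_eval.rCn[of xs gs ys]) (auto simp: list_all2_conv_all_nth)
next
  case (Pr f g)
  have *: "M (triple (enc (Pr f g)) (list_encode (n # zs)) y) \<Longrightarrow> rec_eval (Pr f g) (n # zs) y" for n zs y
  proof (induction n arbitrary: y)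
    case 0
    then have "just M (enc (Pr f g)) (lcons 0 (list_encode zs)) y" using M
      by (auto simp: closed_under_just_def )
    then have "M (triple (enc f) (list_encode zs) y)" by (auto simp: just_def)
    then show ?case using Pr.IH(1) by (auto intro: rec_eval.intros)
  next
    case (Suc n)
    then have "just M (enc (Pr f g)) (lcons (Suc n) (list_encode zs)) y" using M
      by (auto simp: closed_under_just_def )
    then obtain v where "M (triple (enc (Pr f g)) (lcons n (list_encode zs)) v)"
      "M (triple (enc g) (lcons n (lcons v (list_encode zs))) y)" by (auto simp: just_def)
    then have "rec_eval (Pr f g) (n # zs) v" "rec_eval g (n # v # zs) y"
      using Suc.IH Pr.IH(2)[of "n # v # zs"] by (auto )
    then show ?case by (rule rec_eval.rPrS)
  qed
  show ?case
  proof (cases xs)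
    case Nil
    have "just M (enc (Pr f g)) (list_encode xs) y" using M Pr.prems by (auto simp: closed_under_just_def)
    with Nil show ?thesis by (auto simp: just_def lcons_def)
  qed (use * Pr.prems in blast)
next
  case (Mn f)
  then have "just M (enc (Mn f)) (list_encode xs) y" using M by (auto simp: closed_under_just_def)
  then have "M (triple (enc f) (list_encode (y # xs)) 0)"
    "\<forall>m<y. \<exists>v. 0 < v \<and> M (triple (enc f) (list_encode (m # xs)) v)"
    by (auto simp: just_def )
  then show ?case using Mn.IH by (intro rec_eval.rMn) blast+
qed

section \<open>Finite derivations\<close>

lemma just_mono:
  assumes "\<And>x. M x \<Longrightarrow> N x" "just M f xs y"
  shows "just N f xs y"
proof -
  have "M x \<longrightarrow> N x" for x using assms(1) by simp
  then have "just M f xs y \<longrightarrow> just N f xs y"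
    unfolding just_def by (intro imp_refl disj_mono conj_mono ex_mono all_mono imp_mono)
  with assms(2) show ?thesis by simp
qed

lemma closed_under_just_Un:
  assumes "\<And>T. T \<in> \<T> \<Longrightarrow> closed_under_just (\<lambda>x. x \<in> T)"
  shows "closed_under_just (\<lambda>x. x \<in> \<Union>\<T>)"
  unfolding closed_under_just_def
proof (intro allI impI)
  fix f xs y assume "triple f xs y \<in> \<Union>\<T>"
  then obtain T where "T \<in> \<T>" "triple f xs y \<in> T" by blast
  then have "just (\<lambda>x. x \<in> T) f xs y" using assms by (auto simp: closed_under_just_def)
  then show "just (\<lambda>x. x \<in> \<Union>\<T>) f xs y" by (rule just_mono[rotated]) (use \<open>T \<in> \<T>\<close> in blast)
qed

lemma triple_eq_iff: "triple a b c = triple a' b' c' \<longleftrightarrow> a = a' \<and> b = b' \<and> c = c'"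
  by (simp add: triple_def)

lemma closed_insert:
  assumes "closed_under_just (\<lambda>x. x \<in> T)" "just (\<lambda>x. x \<in> T) f xs y"
  shows "closed_under_just (\<lambda>x. x \<in> insert (triple f xs y) T)"
  unfolding closed_under_just_def
proof (intro allI impI)
  fix f' xs' y' assume "triple f' xs' y' \<in> insert (triple f xs y) T"
  then have "just (\<lambda>x. x \<in> T) f' xs' y'"
    using assms by (auto simp: closed_under_just_def triple_eq_iff)
  then show "just (\<lambda>x. x \<in> insert (triple f xs y) T) f' xs' y'"
    by (rule just_mono[rotated]) blast
qed

text \<open>Finiteness allows a whole derivation to be stored in the bits of one number, so that it
  can be found by search.\<close>

definition derivable :: "nat \<Rightarrow> bool" where
  "derivable j \<longleftrightarrow> (\<exists>T. finite T \<and> closed_under_just (\<lambda>x. x \<in> T) \<and> j \<in> T)"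

lemma derivable_finite:
  assumes "finite J" "\<And>j. j \<in> J \<Longrightarrow> derivable j"
  obtains T where "finite T" "closed_under_just (\<lambda>x. x \<in> T)" "J \<subseteq> T"
proof -
  from assms(2) obtain F where F: "\<And>j. j \<in> J \<Longrightarrow> finite (F j) \<and> closed_under_just (\<lambda>x. x \<in> F j) \<and> j \<in> F j"
    unfolding derivable_def by metis
  show ?thesis
  proof (rule that[of "\<Union>(F ` J)"])
    show "closed_under_just (\<lambda>x. x \<in> \<Union>(F ` J))"
      by (rule closed_under_just_Un) (use F in auto)
  qed (use F assms(1) in auto)
qed

lemma derivableI:
  assumes "finite J" "\<And>j. j \<in> J \<Longrightarrow> derivable j" "just (\<lambda>x. x \<in> J) f xs y"
  shows "derivable (triple f xs y)"
proof -
  obtain T where T: "finite T" "closed_under_just (\<lambda>x. x \<in> T)" "J \<subseteq> T"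
    using derivable_finite[OF assms(1,2)] by blast
  have "just (\<lambda>x. x \<in> T) f xs y" using assms(3) by (rule just_mono[rotated]) (use T(3) in blast)
  then show ?thesis unfolding derivable_def
    using T closed_insert by (intro exI[of _ "insert (triple f xs y) T"]) auto
qed

text \<open>Each rule instance has finitely many premises, \<open>rMn\<close> included because its
  quantifier runs below \<open>n\<close>. Their derivations have a finite union, to which the
  conclusion is added.\<close>

lemma rec_eval_derivable: "rec_eval p xs y \<Longrightarrow> derivable (triple (enc p) (list_encode xs) y)"
proof (induction rule: rec_eval.induct)
  case (rZ xs)
  show ?case by (rule derivableI[of "{}"]) (auto simp: just_def)
next
  case (rS x xs)
  show ?case by (rule derivableI[of "{}"]) (auto simp: just_def )
next
  case (rId i xs)
  have "drop i xs = xs ! i # drop (Suc i) xs" using rId by (simp add: Cons_nth_drop_Suc)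
  then have "ldrop i (list_encode xs) = lcons (xs ! i) (list_encode (drop (Suc i) xs))"
    by (simp add: ldrop_list_encode lcons_def)
  then show ?case by (intro derivableI[of "{}"]) (auto simp: just_def)
next
  case (rCn xs gs ys f y)
  have len: "length ys = length gs" using rCn.IH(1) by (simp add: list_all2_lengthD)
  let ?J = "insert (triple (enc f) (list_encode ys) y)
     ((\<lambda>r. triple (enc (gs ! r)) (list_encode xs) (ys ! r)) ` {..<length gs})"
  have ld: "ldrop r (list_encode (map enc gs)) = lcons (enc (gs ! r)) (list_encode (drop (Suc r) (map enc gs)))"
    "ldrop r (list_encode ys) = lcons (ys ! r) (list_encode (drop (Suc r) ys))" if "r < length gs" for r
    using that len by (simp_all add: ldrop_list_encode_lcons)
  show ?case
  proof (rule derivableI[of ?J])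
    show "derivable j" if "j \<in> ?J" for j
      using that rCn.IH by (auto simp: list_all2_conv_all_nth)
    have "(ldrop r (list_encode (map enc gs)) = 0 \<longleftrightarrow> ldrop r (list_encode ys) = 0) \<and>
      (ldrop r (list_encode (map enc gs)) \<noteq> 0 \<longrightarrow>
        triple (lhd (ldrop r (list_encode (map enc gs)))) (list_encode xs) (lhd (ldrop r (list_encode ys))) \<in> ?J)" for r
    proof (cases "r < length gs")
      case True
      then show ?thesis unfolding ld[OF True] by simp
    next
      case False
      then show ?thesis using len by (simp add: ldrop_list_encode)
    qed
    then show "just (\<lambda>x. x \<in> ?J) (enc (Cn f gs)) (list_encode xs) y"
      unfolding just_def enc.simps by (intro disjI2 disjI1 exI conjI) (rule refl, blast+)
  qed auto
next
  case (rPr0 f xs y g)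
  then show ?case
    by (intro derivableI[of "{triple (enc f) (list_encode xs) y}"])
      (auto simp: just_def )
next
  case (rPrS f g n xs y z)
  then show ?case
    by (intro derivableI[of "{triple (enc (Pr f g)) (list_encode (n # xs)) y,
        triple (enc g) (list_encode (n # y # xs)) z}"])
      (auto simp: just_def )
next
  case (rMn f n xs)
  from rMn.IH(2) obtain v where v: "\<And>m. m < n \<Longrightarrow> derivable (triple (enc f) (list_encode (m # xs)) (v m)) \<and> 0 < v m"
    by metis
  show ?case
    by (rule derivableI[of "insert (triple (enc f) (list_encode (n # xs)) 0)
        ((\<lambda>m. triple (enc f) (list_encode (m # xs)) (v m)) ` {..<n})"])
      (use rMn.IH(1) v in \<open>auto simp: just_def \<close>)
qed

section \<open>Decidable checking of derivations\<close>

lemma decidable_app4: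
  assumes "decidable (\<lambda>\<sigma>. P (\<sigma> 0) (\<sigma> 1) (\<sigma> 2) (\<sigma> 3))" "computable a" "computable b" "computable c" "computable d"
  shows "decidable (\<lambda>\<sigma>. P (a \<sigma>) (b \<sigma>) (c \<sigma>) (d \<sigma>))"
  using computable_app4[OF assms(1)[unfolded decidable_def] assms(2-)] unfolding decidable_def .

lemma decidable_app5:
  assumes "decidable (\<lambda>\<sigma>. P (\<sigma> 0) (\<sigma> 1) (\<sigma> 2) (\<sigma> 3) (\<sigma> 4))" "computable a" "computable b" "computable c" "computable d"
    "computable e"
  shows "decidable (\<lambda>\<sigma>. P (a \<sigma>) (b \<sigma>) (c \<sigma>) (d \<sigma>) (e \<sigma>))"
  using computable_app5[OF assms(1)[unfolded decidable_def] assms(2-)] unfolding decidable_def .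

definition hasbit :: "nat \<Rightarrow> nat \<Rightarrow> bool" where
  "hasbit j x \<longleftrightarrow> odd (x div 2 ^ j)"

lemma hasbit_iff_set_decode: "hasbit j x \<longleftrightarrow> j \<in> set_decode x"
  by (simp add: hasbit_def set_decode_def)

lemma hasbit_less: "hasbit j x \<Longrightarrow> j < x"
  by (metis div_less dvd_0_right hasbit_def less_exp not_less_iff_gr_or_eq order.strict_trans)

lemma decidable_hasbit: "computable a \<Longrightarrow> computable b \<Longrightarrow> decidable (\<lambda>\<sigma>. hasbit (a \<sigma>) (b \<sigma>))"
  unfolding hasbit_def by (intro computable_intros)

lemma computable_prod_encode: "computable a \<Longrightarrow> computable b \<Longrightarrow> computable (\<lambda>\<sigma>. prod_encode (a \<sigma>, b \<sigma>))"
  unfolding prod_encode_def triangle_def by (simp only: prod.case) (intro computable_intros)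

lemma computable_lcons: "computable a \<Longrightarrow> computable b \<Longrightarrow> computable (\<lambda>\<sigma>. lcons (a \<sigma>) (b \<sigma>))"
  unfolding lcons_def by (intro computable_intros computable_prod_encode)

lemma computable_triple: "computable a \<Longrightarrow> computable b \<Longrightarrow> computable c \<Longrightarrow> computable (\<lambda>\<sigma>. triple (a \<sigma>) (b \<sigma>) (c \<sigma>))"
  unfolding triple_def by (intro computable_intros computable_prod_encode)

lemma computable_lhd: "computable a \<Longrightarrow> computable (\<lambda>\<sigma>. lhd (a \<sigma>))"
proof (rule computable_app1[where F = lhd])
  show "computable (\<lambda>\<sigma>. lhd (\<sigma> 0))" unfolding lhd_def by (intro computable_intros computable_lcons)
qed

lemma computable_ltl: "computable a \<Longrightarrow> computable (\<lambda>\<sigma>. ltl (a \<sigma>))"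
proof (rule computable_app1[where F = ltl])
  show "computable (\<lambda>\<sigma>. ltl (\<sigma> 0))" unfolding ltl_def by (intro computable_intros computable_lcons)
qed

lemma computable_ldrop: "computable a \<Longrightarrow> computable b \<Longrightarrow> computable (\<lambda>\<sigma>. ldrop (a \<sigma>) (b \<sigma>))"
proof (rule computable_app2[where F = ldrop])
  show "computable (\<lambda>\<sigma>. ldrop (\<sigma> 0) (\<sigma> 1))"
    unfolding ldrop_def by (rule computable_rec_nat[where h = "\<lambda>_ acc _. ltl acc"]) (intro computable_intros computable_ltl)+
qed

lemma lcons_cases:
  assumes "l \<noteq> 0"
  obtains a r where "l = lcons a r"
proof -
  obtain n where "l = Suc n" using assms by (cases l) auto
  then have "l = lcons (fst (prod_decode n)) (snd (prod_decode n))" by (simp add: lcons_def)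
  then show ?thesis by (rule that)
qed

text \<open>The tail of a nonempty list has a smaller code, so \<open>l\<close> steps exhaust the
  list. This bounds the position \<open>r\<close> in the rule for \<open>Cn\<close>.\<close>

lemma ldrop_ge: "l \<le> n \<Longrightarrow> ldrop n l = 0"
proof (induction n arbitrary: l)
  case (Suc n)
  show ?case
  proof (cases "l = 0")
    case True
    have "ldrop n 0 = 0" for n by (induction n) (simp_all add: ldrop_def ltl_def)
    with True show ?thesis by simp
  next
    case False
    then obtain a r where l: "l = lcons a r" by (rule lcons_cases)
    with Suc.prems lcons_gt(2)[of r a] have "r \<le> n" by linarith
    with Suc.IH l show ?thesis by simp
  qed
qed simp

text \<open>\<open>just\<close> for the set of bits of \<open>W\<close>, with all quantifiers
  bounded to make it decidable: a code bounds its components, and \<open>W\<close> bounds the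
  components of every triple among its bits.\<close>

definition bjust :: "nat \<Rightarrow> nat \<Rightarrow> nat \<Rightarrow> nat \<Rightarrow> bool" where
  "bjust W f xs y \<longleftrightarrow>
     f = prod_encode (0, 0) \<and> y = 0
   \<or> f = prod_encode (1, 0) \<and> (\<exists>a\<le>xs. \<exists>r\<le>xs. xs = lcons a r \<and> y = Suc a)
   \<or> (\<exists>i\<le>f. f = prod_encode (2, i) \<and> ldrop i xs \<noteq> 0 \<and> y = lhd (ldrop i xs))
   \<or> (\<exists>g\<le>f. \<exists>gs\<le>f. \<exists>ys\<le>W. f = prod_encode (3, prod_encode (g, gs)) \<and> hasbit (triple g ys y) W \<and>
        (\<forall>r\<le>gs + ys. (ldrop r gs = 0 \<longleftrightarrow> ldrop r ys = 0) \<and>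
             (ldrop r gs \<noteq> 0 \<longrightarrow> hasbit (triple (lhd (ldrop r gs)) xs (lhd (ldrop r ys))) W)))
   \<or> (\<exists>g\<le>f. \<exists>h\<le>f. \<exists>r\<le>xs. f = prod_encode (4, prod_encode (g, h)) \<and> xs = lcons 0 r \<and> hasbit (triple g r y) W)
   \<or> (\<exists>g\<le>f. \<exists>h\<le>f. \<exists>r\<le>xs. \<exists>n\<le>xs. \<exists>v\<le>W. f = prod_encode (4, prod_encode (g, h)) \<and> xs = lcons (Suc n) r \<and>
        hasbit (triple f (lcons n r) v) W \<and> hasbit (triple h (lcons n (lcons v r)) y) W)
   \<or> (\<exists>g\<le>f. f = prod_encode (5, g) \<and> hasbit (triple g (lcons y xs) 0) W \<and>
        (\<forall>m<y. \<exists>v\<le>W. 0 < v \<and> hasbit (triple g (lcons m xs) v) W))"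

lemma decidable_bjust: "decidable (\<lambda>\<sigma>. bjust (\<sigma> 0) (\<sigma> 1) (\<sigma> 2) (\<sigma> 3))"
  unfolding bjust_def
  by (intro computable_intros decidable_hasbit computable_prod_encode computable_lcons computable_triple computable_lhd computable_ldrop)

lemma hasbit_triple_le:
  assumes "hasbit (triple f xs y) W"
  shows "f \<le> W" "xs \<le> W" "y \<le> W"
proof -
  have "triple f xs y \<le> W" using assms hasbit_less by (simp add: less_imp_le)
  then show "f \<le> W" "xs \<le> W" "y \<le> W"
    unfolding triple_def using le_prod_encode_1 le_prod_encode_2 by (meson order_trans)+
qed

lemma prod_encode_tag_le:
  "f = prod_encode (k, i) \<Longrightarrow> i \<le> f"
  "f = prod_encode (k, prod_encode (g, h)) \<Longrightarrow> g \<le> f"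
  "f = prod_encode (k, prod_encode (g, h)) \<Longrightarrow> h \<le> f"
  using le_prod_encode_1 le_prod_encode_2 by (meson order_trans)+

lemma lcons_le:
  "xs = lcons a r \<Longrightarrow> a \<le> xs" "xs = lcons a r \<Longrightarrow> r \<le> xs" "xs = lcons (Suc n) r \<Longrightarrow> n \<le> xs"
  using lcons_gt(1)[of a r] lcons_gt(2)[of r a] lcons_gt(1)[of "Suc n" r] by auto

lemma bjust_iff: "bjust W f xs y \<longleftrightarrow> just (\<lambda>j. hasbit j W) f xs y"
proof -
  have all: "(\<forall>r. P (ldrop r gs) (ldrop r ys)) \<longleftrightarrow> (\<forall>r\<le>gs + ys. P (ldrop r gs) (ldrop r ys))" for P gs ys
  proof (intro iffI allI impI)
    fix r assume *: "\<forall>r\<le>gs + ys. P (ldrop r gs) (ldrop r ys)"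
    show "P (ldrop r gs) (ldrop r ys)"
    proof (cases "r \<le> gs + ys")
      case False
      then have "ldrop r gs = 0" "ldrop r ys = 0" by (simp_all add: ldrop_ge)
      \<comment> \<open>Both drops already vanish at \<open>gs + ys\<close>, so this instance is
        \<open>P 0 0\<close> as well.\<close>
      then show ?thesis using *[rule_format, of "gs + ys"] by (simp add: ldrop_ge)
    qed (use * in simp)
  qed simp
  have bex1: "(\<exists>x\<le>a. P x) \<longleftrightarrow> (\<exists>x. P x)" if "\<And>x. P x \<Longrightarrow> x \<le> a" for a :: nat and P
    using that by blast
  have bex2: "(\<exists>x\<le>a. \<exists>y\<le>b. P x y) \<longleftrightarrow> (\<exists>x y. P x y)"
    if "\<And>x y. P x y \<Longrightarrow> x \<le> a \<and> y \<le> b" for a b :: nat and P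
    using that by blast
  have bex3: "(\<exists>x\<le>a. \<exists>y\<le>b. \<exists>z\<le>c. P x y z) \<longleftrightarrow> (\<exists>x y z. P x y z)"
    if "\<And>x y z. P x y z \<Longrightarrow> x \<le> a \<and> y \<le> b \<and> z \<le> c" for a b c :: nat and P
    using that by blast
  have bex5: "(\<exists>x\<le>a. \<exists>y\<le>b. \<exists>z\<le>c. \<exists>v\<le>d. \<exists>w\<le>e. P x y z v w) \<longleftrightarrow> (\<exists>x y z v w. P x y z v w)"
    if "\<And>x y z v w. P x y z v w \<Longrightarrow> x \<le> a \<and> y \<le> b \<and> z \<le> c \<and> v \<le> d \<and> w \<le> e"
    for a b c d e :: nat and P
    using that by blast
  note all' = all[where P = "\<lambda>a b. (a = 0 \<longleftrightarrow> b = 0) \<and>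
    (a \<noteq> 0 \<longrightarrow> hasbit (triple (lhd a) xs (lhd b)) W)"]
  show ?thesis
    unfolding bjust_def just_def all'
  proof (intro arg_cong2[of _ _ _ _ "(\<or>)"] arg_cong2[of _ _ _ _ "(\<and>)"] refl, goal_cases)
    case 1
    show ?case by (rule bex2, (elim conjE, (intro conjI)?; erule prod_encode_tag_le lcons_le hasbit_triple_le))
  next
    case 2
    show ?case by (rule bex1, (elim conjE, (intro conjI)?; erule prod_encode_tag_le lcons_le hasbit_triple_le))
  next
    case 3
    show ?case by (rule bex3, (elim conjE, (intro conjI)?; erule prod_encode_tag_le lcons_le hasbit_triple_le))
  next
    case 4
    show ?case by (rule bex3, (elim conjE, (intro conjI)?; erule prod_encode_tag_le lcons_le hasbit_triple_le))
  next
    case 5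
    show ?case by (rule bex5, (elim conjE, (intro conjI)?; erule prod_encode_tag_le lcons_le hasbit_triple_le))
  next
    case 6
    have "(\<exists>v\<le>W. 0 < v \<and> hasbit (triple g (lcons m xs) v) W) \<longleftrightarrow>
      (\<exists>v. 0 < v \<and> hasbit (triple g (lcons m xs) v) W)" for g m
      by (rule bex1, (elim conjE, (intro conjI)?; erule prod_encode_tag_le lcons_le hasbit_triple_le))
    then show ?case by (simp only:) (rule bex1, elim conjE, erule prod_encode_tag_le)
  qed
qed

definition bclosed :: "nat \<Rightarrow> bool" where
  "bclosed W \<longleftrightarrow> (\<forall>f\<le>W. \<forall>xs\<le>W. \<forall>y\<le>W. hasbit (triple f xs y) W \<longrightarrow> bjust W f xs y)"

lemma bclosed_iff: "bclosed W \<longleftrightarrow> closed_under_just (\<lambda>j. hasbit j W)"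
  unfolding bclosed_def closed_under_just_def bjust_iff
proof (intro iffI allI impI)
  fix f xs y
  assume *: "\<forall>f\<le>W. \<forall>xs\<le>W. \<forall>y\<le>W. hasbit (triple f xs y) W \<longrightarrow> just (\<lambda>j. hasbit j W) f xs y"
    and "hasbit (triple f xs y) W"
  with hasbit_triple_le[OF this(2)] show "just (\<lambda>j. hasbit j W) f xs y" by blast
qed blast

text \<open>Stage \<open>t\<close> of the universal condition on \<open>z\<close>: below
  \<open>t\<close> there is no counterexample \<open>z\<close> together with a derivation
  \<open>W\<close> of the value 0, that is, of falsity.\<close>

definition unrefuted :: "nat \<Rightarrow> nat \<Rightarrow> nat \<Rightarrow> nat \<Rightarrow> nat \<Rightarrow> bool" where
  "unrefuted e n x y t \<longleftrightarrow>
     \<not> (\<exists>z<t. \<exists>W<t. bclosed W \<and> hasbit (triple e (lcons n (lcons x (lcons y (lcons z 0)))) 0) W)"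

lemma decidable_unrefuted:
  assumes "computable a" "computable b" "computable c" "computable d"
    "computable e"
  shows "decidable (\<lambda>\<sigma>. unrefuted (a \<sigma>) (b \<sigma>) (c \<sigma>) (d \<sigma>) (e \<sigma>))"
proof (rule decidable_app5[where P = unrefuted, OF _ assms])
  show "decidable (\<lambda>\<sigma>. unrefuted (\<sigma> 0) (\<sigma> 1) (\<sigma> 2) (\<sigma> 3) (\<sigma> 4))"
    unfolding unrefuted_def bclosed_def
    by (intro computable_intros decidable_hasbit computable_lcons computable_triple decidable_app4[where P = bjust, OF decidable_bjust])
qed

lemma unrefuted_antimono: "unrefuted e n x y t \<Longrightarrow> t' \<le> t \<Longrightarrow> unrefuted e n x y t'"
  unfolding unrefuted_def by (meson less_le_trans)

text \<open>Soundness and determinism show that a true instance is never refuted. Conversely a false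
  instance has a finite derivation of 0, whose code appears at some stage.\<close>

lemma unrefuted_universal:
  assumes "recursive_rel4 R"
  shows "\<exists>e. \<forall>n x y. (\<forall>z. R n x y z) \<longleftrightarrow> (\<forall>t. unrefuted e n x y t)"
proof -
  obtain p where p: "\<And>a b c d. rec_eval p [a, b, c, d] (if R a b c d then 1 else 0)"
    using assms unfolding recursive_rel4_def by blast
  have code: "lcons n (lcons x (lcons y (lcons z 0))) = list_encode [n, x, y, z]" for n x y z
    by simp
  have "(\<forall>z. R n x y z) \<longleftrightarrow> (\<forall>t. unrefuted (enc p) n x y t)" for n x y
  proof (intro iffI allI)
    fix t assume R: "\<forall>z. R n x y z"
    show "unrefuted (enc p) n x y t"
      unfolding unrefuted_def code
    proof (intro notI, elim exE conjE)
      fix z W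
      assume "bclosed W" "hasbit (triple (enc p) (list_encode [n, x, y, z]) 0) W"
      then have "rec_eval p [n, x, y, z] 0" using just_sound unfolding bclosed_iff by blast
      moreover have "rec_eval p [n, x, y, z] 1" using p[of n x y z] R by simp
      ultimately show False using rec_eval_det by fastforce
    qed
  next
    fix z assume V: "\<forall>t. unrefuted (enc p) n x y t"
    show "R n x y z"
    proof (rule ccontr)
      assume "\<not> R n x y z"
      then have "rec_eval p [n, x, y, z] 0" using p[of n x y z] by simp
      then obtain T where T: "finite T" "closed_under_just (\<lambda>j. j \<in> T)"
        "triple (enc p) (list_encode [n, x, y, z]) 0 \<in> T"
        using rec_eval_derivable unfolding derivable_def by blast
      define W where "W = set_encode T"
      have W: "hasbit j W \<longleftrightarrow> j \<in> T" for j using T(1) by (simp add: hasbit_iff_set_decode W_def)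
      have "\<not> unrefuted (enc p) n x y (Suc (z + W))"
        unfolding unrefuted_def code bclosed_iff not_not
        by (rule exI[of _ z], rule conjI, simp, rule exI[of _ W]) (use T(2,3) in \<open>simp add: W\<close>)
      with V show False by blast
    qed
  qed
  then show ?thesis by blast
qed

section \<open>The coloring\<close>

text \<open>A bounded form of \<open>\<Sum>(set_decode F)\<close>: finite sets are coded by bits,
  and each bit position of \<open>F\<close> is below \<open>F\<close>.\<close>

definition code_sum :: "nat \<Rightarrow> nat" where
  "code_sum F = (\<Sum>f<F. if hasbit f F then f else 0)"

definition top_bit :: "nat \<Rightarrow> nat \<Rightarrow> bool" where
  "top_bit p x \<longleftrightarrow> 2 ^ p \<le> x \<and> x < 2 ^ Suc p"

text \<open>An index \<open>e\<close> stands for the \<open>\<Pi>\<^sup>0\<^sub>3\<close> set with program \<open>e div 2\<close>, together with the guess \<open>e mod 2\<close> for the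
  colour of a solution. As \<open>t\<close> grows the level converges, and its limit is unbounded in \<open>a\<close> if and only if the
  finite set coded by \<open>F\<close> is contained in the \<open>\<Pi>\<^sup>0\<^sub>3\<close> set.\<close>

definition stage_level :: "nat \<Rightarrow> nat \<Rightarrow> nat \<Rightarrow> nat \<Rightarrow> nat" where
  "stage_level e F a t = (\<Sum>u<a. of_bool (\<forall>f<F. hasbit f F \<longrightarrow> (\<forall>x\<le>u. \<exists>y<a. unrefuted (e div 2) f x y t)))"

text \<open>Growth of the level between \<open>p'\<close> and \<open>a\<close> is evidence that it
  is unbounded, hence that some finite subset of the indexed set has a sum with top bit
  \<open>p\<close>. The bound covers the codes of all sets whose sum is below
  \<open>2 ^ Suc p\<close>.\<close>

definition rises :: "nat \<Rightarrow> nat \<Rightarrow> nat \<Rightarrow> nat \<Rightarrow> nat \<Rightarrow> bool" where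
  "rises e p p' a t \<longleftrightarrow> (\<exists>F<2 ^ 2 ^ Suc p. top_bit p (code_sum F) \<and> stage_level e F p' t < stage_level e F a t)"

text \<open>Each index claims at most \<open>2 ^ e\<close> positions, so the smaller indices together leave it at least one.\<close>

definition eligible :: "nat \<Rightarrow> nat \<Rightarrow> nat \<Rightarrow> nat \<Rightarrow> nat \<Rightarrow> bool" where
  "eligible e p p' a t \<longleftrightarrow> e \<le> p \<and> rises e p p' a t \<and>
     (\<Sum>p1<p. of_bool (e \<le> p1 \<and> rises e p1 p' a t)) < (2::nat) ^ e"

definition served :: "nat \<Rightarrow> nat \<Rightarrow> nat \<Rightarrow> nat \<Rightarrow> nat" where
  "served p p' a t = bleast (Suc p) (\<lambda>e. eligible e p p' a t)"

text \<open>Candidate pairs \<open>(F, F')\<close> of codes below \<open>code_bound p'\<close> are coded as \<open>F * code_bound p' + F'\<close>.\<close>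

definition candidate :: "nat \<Rightarrow> nat \<Rightarrow> nat \<Rightarrow> nat \<Rightarrow> bool" where
  "candidate p p' F F' \<longleftrightarrow> top_bit p (code_sum F) \<and> top_bit p' (code_sum F') \<and> 2 ^ Suc p dvd code_sum F' \<and>
     (\<forall>f<F. \<not> (hasbit f F \<and> hasbit f F'))"

text \<open>Every set whose sum is below \<open>2 ^ Suc p'\<close> has its code below this
  number.\<close>

definition code_bound :: "nat \<Rightarrow> nat" where
  "code_bound p' = 2 ^ 2 ^ Suc p'"

text \<open>For disjoint sets \<open>F + F'\<close> codes the union. Maximising its level picks a
  pair inside the indexed set once \<open>a\<close> is so large that true pairs have overtaken the
  bounded levels of all false ones.\<close>

definition selected :: "nat \<Rightarrow> nat \<Rightarrow> nat \<Rightarrow> nat \<Rightarrow> nat \<Rightarrow> nat" where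
  "selected e p p' a t = bleast (code_bound p' * code_bound p') (\<lambda>Q. candidate p p' (Q div code_bound p') (Q mod code_bound p') \<and>
     (\<forall>Q'<code_bound p' * code_bound p'. candidate p p' (Q' div code_bound p') (Q' mod code_bound p') \<longrightarrow>
        stage_level e (Q' div code_bound p' + Q' mod code_bound p') a t \<le> stage_level e (Q div code_bound p' + Q mod code_bound p') a t))"

definition selected_low :: "nat \<Rightarrow> nat \<Rightarrow> nat \<Rightarrow> nat \<Rightarrow> nat" where
  "selected_low p p' a t = selected (served p p' a t) p p' a t div code_bound p'"

definition selected_high :: "nat \<Rightarrow> nat \<Rightarrow> nat \<Rightarrow> nat \<Rightarrow> nat" where
  "selected_high p p' a t = selected (served p p' a t) p p' a t mod code_bound p'"

text \<open>Digits in base \<open>t\<close>, so that for digits below \<open>t\<close> the numerical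
  order is the lexicographic order of \<open>(a, p', p)\<close> in which the table is
  filled.\<close>

definition table_index :: "nat \<Rightarrow> nat \<Rightarrow> nat \<Rightarrow> nat \<Rightarrow> nat" where
  "table_index t a p' p = (a * t + p') * t + p"

text \<open>\<open>W\<close> codes the set of table indices with entry 1.\<close>

definition quad_form :: "nat \<Rightarrow> nat \<Rightarrow> nat \<Rightarrow> nat" where
  "quad_form W t x = (\<Sum>a<t. \<Sum>p'<a. \<Sum>p<p'.
     of_bool (top_bit a x \<and> hasbit p' x \<and> hasbit p x \<and> hasbit (table_index t a p' p) W))"

definition cross_form :: "nat \<Rightarrow> nat \<Rightarrow> nat \<Rightarrow> nat \<Rightarrow> nat \<Rightarrow> nat" where
  "cross_form W t a m m' = (\<Sum>q<t. \<Sum>q'<t. of_bool (hasbit q m \<and> hasbit q' m' \<and> hasbit (table_index t a q' q) W))"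

text \<open>Modulo 2 this is the sum of \<open>quad_form W t\<close> over the cube spanned by
  \<open>m\<close>, \<open>m'\<close> and a further number stacked above them with top bit
  \<open>a\<close>; see \<open>cube_quad_form\<close>.\<close>

definition defect :: "nat \<Rightarrow> nat \<Rightarrow> nat \<Rightarrow> nat \<Rightarrow> nat \<Rightarrow> nat" where
  "defect W t a m m' = quad_form W t m + quad_form W t m' + quad_form W t (m + m') + cross_form W t a m m'"

text \<open>By \<open>even_defect\<close> below a solution of colour \<open>\<gamma>\<close> makes \<open>\<gamma> + defect W t a m m'\<close> even. The new entry occurs
  exactly once in this sum, and it is chosen to make the sum odd. Only the parity of the served index matters.\<close>

definition table_bit :: "nat \<Rightarrow> nat \<Rightarrow> nat \<Rightarrow> nat \<Rightarrow> nat \<Rightarrow> bool" where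
  "table_bit W t a p' p \<longleftrightarrow>
     even (served p p' a t + defect W t a (code_sum (selected_low p p' a t)) (code_sum (selected_high p p' a t)))"

text \<open>Course-of-values recursion: the entry with index \<open>s\<close> is computed from all
  earlier entries, which the accumulator holds as its bits.\<close>

definition table :: "nat \<Rightarrow> nat \<Rightarrow> nat" where
  "table t n = rec_nat 0 (\<lambda>s W. W + (if table_bit W t (s div (t * t)) (s div t mod t) (s mod t) then 2 ^ s else 0)) n"

text \<open>\<open>t ^ 3\<close> exceeds every index with digits below \<open>t\<close>, so the
  table is complete for the form \<open>quad_form\<close> at \<open>t\<close>.\<close>

definition coloring :: "nat \<Rightarrow> nat" where
  "coloring x = (\<Sum>t<x. if hasbit t x then quad_form (table t (t ^ 3)) t (x mod 2 ^ t) else 0) mod 2"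

section \<open>Computability of the coloring\<close>

lemma computable_code_sum: "computable a \<Longrightarrow> computable (\<lambda>\<sigma>. code_sum (a \<sigma>))"
  unfolding code_sum_def by (rule computable_app1[where F = code_sum, unfolded code_sum_def]) (intro computable_intros decidable_hasbit)

lemma decidable_top_bit: "computable a \<Longrightarrow> computable b \<Longrightarrow> decidable (\<lambda>\<sigma>. top_bit (a \<sigma>) (b \<sigma>))"
  unfolding top_bit_def by (intro computable_intros)

lemma computable_stage_level:
  assumes "computable a" "computable b" "computable c" "computable d"
  shows "computable (\<lambda>\<sigma>. stage_level (a \<sigma>) (b \<sigma>) (c \<sigma>) (d \<sigma>))"
proof (rule computable_app4[where F = stage_level, OF _ assms])
  show "computable (\<lambda>\<sigma>. stage_level (\<sigma> 0) (\<sigma> 1) (\<sigma> 2) (\<sigma> 3))"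
    unfolding stage_level_def by (intro computable_intros decidable_hasbit decidable_unrefuted)
qed

lemma decidable_rises:
  assumes "computable a" "computable b" "computable c" "computable d"
    "computable e"
  shows "decidable (\<lambda>\<sigma>. rises (a \<sigma>) (b \<sigma>) (c \<sigma>) (d \<sigma>) (e \<sigma>))"
proof (rule decidable_app5[where P = rises, OF _ assms])
  show "decidable (\<lambda>\<sigma>. rises (\<sigma> 0) (\<sigma> 1) (\<sigma> 2) (\<sigma> 3) (\<sigma> 4))"
    unfolding rises_def by (intro computable_intros decidable_top_bit computable_stage_level computable_code_sum)
qed

lemma decidable_eligible:
  assumes "computable a" "computable b" "computable c" "computable d"
    "computable e"
  shows "decidable (\<lambda>\<sigma>. eligible (a \<sigma>) (b \<sigma>) (c \<sigma>) (d \<sigma>) (e \<sigma>))"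
proof (rule decidable_app5[where P = eligible, OF _ assms])
  show "decidable (\<lambda>\<sigma>. eligible (\<sigma> 0) (\<sigma> 1) (\<sigma> 2) (\<sigma> 3) (\<sigma> 4))"
    unfolding eligible_def by (intro computable_intros decidable_rises)
qed

lemma computable_served:
  assumes "computable a" "computable b" "computable c" "computable d"
  shows "computable (\<lambda>\<sigma>. served (a \<sigma>) (b \<sigma>) (c \<sigma>) (d \<sigma>))"
proof (rule computable_app4[where F = served, OF _ assms])
  show "computable (\<lambda>\<sigma>. served (\<sigma> 0) (\<sigma> 1) (\<sigma> 2) (\<sigma> 3))"
    unfolding served_def by (intro computable_intros decidable_eligible)
qed

lemma decidable_candidate:
  assumes "computable a" "computable b" "computable c" "computable d"
  shows "decidable (\<lambda>\<sigma>. candidate (a \<sigma>) (b \<sigma>) (c \<sigma>) (d \<sigma>))"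
proof (rule decidable_app4[where P = candidate, OF _ assms])
  show "decidable (\<lambda>\<sigma>. candidate (\<sigma> 0) (\<sigma> 1) (\<sigma> 2) (\<sigma> 3))"
    unfolding candidate_def by (intro computable_intros decidable_top_bit decidable_hasbit computable_code_sum)
qed

lemma computable_code_bound: "computable a \<Longrightarrow> computable (\<lambda>\<sigma>. code_bound (a \<sigma>))"
  unfolding code_bound_def by (intro computable_intros)

lemma computable_selected:
  assumes "computable a" "computable b" "computable c" "computable d"
    "computable e"
  shows "computable (\<lambda>\<sigma>. selected (a \<sigma>) (b \<sigma>) (c \<sigma>) (d \<sigma>) (e \<sigma>))"
proof (rule computable_app5[where F = selected, OF _ assms])
  show "computable (\<lambda>\<sigma>. selected (\<sigma> 0) (\<sigma> 1) (\<sigma> 2) (\<sigma> 3) (\<sigma> 4))"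
    unfolding selected_def by (intro computable_intros decidable_candidate computable_stage_level computable_code_bound)
qed

lemma computable_table_index: "computable a \<Longrightarrow> computable b \<Longrightarrow> computable c \<Longrightarrow> computable d \<Longrightarrow>
    computable (\<lambda>\<sigma>. table_index (a \<sigma>) (b \<sigma>) (c \<sigma>) (d \<sigma>))"
  unfolding table_index_def by (intro computable_intros)

lemma computable_quad_form:
  assumes "computable a" "computable b" "computable c"
  shows "computable (\<lambda>\<sigma>. quad_form (a \<sigma>) (b \<sigma>) (c \<sigma>))"
proof (rule computable_app3[where F = quad_form, OF _ assms])
  show "computable (\<lambda>\<sigma>. quad_form (\<sigma> 0) (\<sigma> 1) (\<sigma> 2))"
    unfolding quad_form_def by (intro computable_intros decidable_top_bit decidable_hasbit computable_table_index)
qed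

lemma computable_cross_form:
  assumes "computable a" "computable b" "computable c" "computable d"
    "computable e"
  shows "computable (\<lambda>\<sigma>. cross_form (a \<sigma>) (b \<sigma>) (c \<sigma>) (d \<sigma>) (e \<sigma>))"
proof (rule computable_app5[where F = cross_form, OF _ assms])
  show "computable (\<lambda>\<sigma>. cross_form (\<sigma> 0) (\<sigma> 1) (\<sigma> 2) (\<sigma> 3) (\<sigma> 4))"
    unfolding cross_form_def by (intro computable_intros decidable_hasbit computable_table_index)
qed

lemma decidable_table_bit:
  assumes "computable a" "computable b" "computable c" "computable d"
    "computable e"
  shows "decidable (\<lambda>\<sigma>. table_bit (a \<sigma>) (b \<sigma>) (c \<sigma>) (d \<sigma>) (e \<sigma>))"
proof (rule decidable_app5[where P = table_bit, OF _ assms])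
  show "decidable (\<lambda>\<sigma>. table_bit (\<sigma> 0) (\<sigma> 1) (\<sigma> 2) (\<sigma> 3) (\<sigma> 4))"
    unfolding table_bit_def defect_def selected_low_def selected_high_def
    by (intro computable_intros computable_quad_form computable_cross_form computable_served
        computable_selected computable_code_bound computable_code_sum)
qed

lemma computable_table:
  assumes "computable a" "computable b"
  shows "computable (\<lambda>\<sigma>. table (a \<sigma>) (b \<sigma>))"
proof (rule computable_app2[where F = table, OF _ assms])
  show "computable (\<lambda>\<sigma>. table (\<sigma> 0) (\<sigma> 1))"
    unfolding table_def
    by (rule computable_rec_nat[where h = "\<lambda>s W \<sigma>. W +
        (if table_bit W (\<sigma> 0) (s div (\<sigma> 0 * \<sigma> 0)) (s div \<sigma> 0 mod \<sigma> 0) (s mod \<sigma> 0) then 2 ^ s else 0)"])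
      (intro computable_intros decidable_table_bit)+
qed

lemma recursive1_coloring: "recursive1 coloring"
proof (rule recursive1I)
  show "computable (\<lambda>\<sigma>. coloring (\<sigma> 0))"
    unfolding coloring_def by (intro computable_intros decidable_hasbit computable_quad_form computable_table)
qed

section \<open>Binary expansions and the table\<close>

lemma hasbit_lt: "hasbit j n \<Longrightarrow> n < 2 ^ s \<Longrightarrow> j < s"
proof (rule ccontr)
  assume j: "hasbit j n" "n < 2 ^ s" "\<not> j < s"
  then have "n < 2 ^ j"
    by (meson le_less_trans less_le_trans not_less one_le_numeral power_increasing)
  with j(1) show False by (simp add: hasbit_def)
qed

lemma hasbit_ge: "hasbit j k \<Longrightarrow> 2 ^ s dvd k \<Longrightarrow> s \<le> j"
proof (rule ccontr)
  assume j: "hasbit j k" "2 ^ s dvd k" "\<not> s \<le> j"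
  then have "2 ^ Suc j dvd k" by (meson dvd_trans le_imp_power_dvd not_less_eq_eq)
  then obtain q where "k = 2 ^ j * (2 * q)" by (auto elim!: dvdE simp: mult.assoc mult.left_commute)
  with j(1) show False by (simp add: hasbit_def)
qed

text \<open>The supports are separated by position \<open>s\<close>, so no carries occur.\<close>

lemma hasbit_add:
  assumes n: "n < 2 ^ s" and k: "2 ^ s dvd k"
  shows "hasbit j (n + k) \<longleftrightarrow> hasbit j n \<or> hasbit j k"
proof -
  obtain q where q: "k = 2 ^ s * q" using k by auto
  show ?thesis
  proof (cases "s \<le> j")
    case True
    then have "(2::nat) ^ j = 2 ^ s * 2 ^ (j - s)" by (simp flip: power_add)
    then have "(n + k) div 2 ^ j = k div 2 ^ j"
      using n by (simp add: q div_mult2_eq)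
    then show ?thesis using True n hasbit_lt[of j n s] by (auto simp: hasbit_def)
  next
    case False
    then have "(2::nat) ^ s = 2 ^ j * (2 * 2 ^ (s - Suc j))"
      by (simp flip: power_add power_Suc)
    then have "(n + k) div 2 ^ j = n div 2 ^ j + 2 * (2 ^ (s - Suc j) * q)"
      by (simp add: q mult.assoc)
    then show ?thesis using False k hasbit_ge[of j k s] by (auto simp: hasbit_def)
  qed
qed

text \<open>Bits as numbers are additive on stacked sums, so quadratic forms in them can be expanded
  algebraically.\<close>

definition bit_val :: "nat \<Rightarrow> nat \<Rightarrow> nat" where
  "bit_val j x = of_bool (hasbit j x)"

lemma bit_val_add: "n < 2 ^ s \<Longrightarrow> 2 ^ s dvd k \<Longrightarrow> bit_val j (n + k) = bit_val j n + bit_val j k"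
  using hasbit_add[of n s k j] hasbit_lt[of j n s] hasbit_ge[of j k s]
  by (auto simp: bit_val_def)


lemma top_bit_unique: "top_bit a x \<Longrightarrow> top_bit b x \<Longrightarrow> a = b"
  unfolding top_bit_def
  by (metis le_less_trans less_Suc_eq_le nat_neq_iff not_less one_less_numeral_iff power_less_imp_less_exp semiring_norm(76))

lemma top_bit_exists: "0 < x \<Longrightarrow> \<exists>a. top_bit a x"
proof -
  assume "0 < x"
  obtain n where n: "x < 2 ^ n" using less_exp by blast
  define m where "m = (LEAST n. x < 2 ^ n)"
  have m: "x < 2 ^ m" unfolding m_def using n by (rule LeastI)
  then obtain a where a: "m = Suc a" using \<open>0 < x\<close> by (cases m) auto
  then have "\<not> x < 2 ^ a" using not_less_Least[of a "\<lambda>n. x < 2 ^ n"] by (simp add: m_def)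
  with m a show ?thesis unfolding top_bit_def by (auto simp: not_less)
qed

lemma top_bit_hasbit: "top_bit a x \<Longrightarrow> hasbit a x"
proof -
  assume a: "top_bit a x"
  then have "x div 2 ^ a = 1" unfolding top_bit_def
    by (intro div_nat_eqI) auto
  then show ?thesis by (simp add: hasbit_def)
qed

lemma top_bit_add:
  assumes "n < 2 ^ s" "2 ^ s dvd k" "top_bit b k"
  shows "top_bit b (n + k)"
proof -
  have "s \<le> b" using hasbit_ge top_bit_hasbit assms by blast
  then obtain d where d: "Suc b = s + d" by (metis le_Suc_eq le_iff_add)
  obtain q where q: "k = 2 ^ s * q" using assms(2) by auto
  have k: "2 ^ b \<le> k" "k < 2 ^ s * 2 ^ d" using assms(3) d unfolding top_bit_def by (simp_all add: power_add)
  then have "q < 2 ^ d" using q by simp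
  \<comment> \<open>\<open>k\<close> and the upper bound are both multiples of \<open>2 ^ s\<close>,
    which leaves a gap of at least \<open>2 ^ s\<close> to accommodate \<open>n\<close>.\<close>
  then have "2 ^ s * Suc q \<le> 2 ^ s * 2 ^ d" by (intro mult_le_mono2) simp
  then have "n + k < 2 ^ s * 2 ^ d" using assms(1) by (simp add: q)
  with k(1) show ?thesis unfolding top_bit_def d by (simp add: power_add)
qed

lemma top_bit_mono: "top_bit a x \<Longrightarrow> x < 2 ^ b \<Longrightarrow> a < b"
  using top_bit_hasbit hasbit_lt by blast

lemma top_bit_ge: "top_bit a x \<Longrightarrow> 2 ^ b \<le> x \<Longrightarrow> b \<le> a"
  using power_less_imp_less_exp[of "2::nat" b "Suc a"] le_less_trans[of "2 ^ b" x "2 ^ Suc a"]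
  unfolding top_bit_def by linarith

text \<open>Entry \<open>j\<close> is decided at step \<open>j\<close> from the entries before it,
  and later steps add only higher powers of 2.\<close>

lemma hasbit_table:
  "hasbit j (table t n) \<longleftrightarrow> j < n \<and> table_bit (table t j) t (j div (t * t)) (j div t mod t) (j mod t)"
proof (induction n arbitrary: j)
  case 0
  then show ?case by (simp add: table_def hasbit_def)
next
  case (Suc n)
  let ?d = "table_bit (table t n) t (n div (t * t)) (n div t mod t) (n mod t)"
  have table: "table t (Suc n) = table t n + (if ?d then 2 ^ n else 0)" by (simp add: table_def)
  have n: "n \<notin> set_decode (table t n)" using Suc.IH[of n] by (simp add: hasbit_iff_set_decode)
  have "hasbit j (table t (Suc n)) \<longleftrightarrow> hasbit j (table t n) \<or> ?d \<and> j = n"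
    unfolding table hasbit_iff_set_decode
    using set_decode_plus_power_2[OF n] by (auto simp: add.commute)
  then show ?case using Suc.IH[of j] by (auto simp: less_Suc_eq)
qed

lemma table_index_decode:
  assumes "a < t" "p' < t" "p < t"
  shows "table_index t a p' p < t ^ 3" "table_index t a p' p div (t * t) = a"
    "table_index t a p' p div t mod t = p'" "table_index t a p' p mod t = p"
proof -
  have t: "0 < t" using assms by simp
  have div: "table_index t a p' p div t = a * t + p'" using assms t by (simp add: table_index_def)
  show "table_index t a p' p mod t = p" using assms by (simp add: table_index_def)
  show "table_index t a p' p div t mod t = p'" using assms by (simp add: div)
  show "table_index t a p' p div (t * t) = a" using assms t by (simp add: div_mult2_eq div)
  have "a * t + p' < t * t" using assms
    by (metis add.commute less_le_trans mult_Suc mult_le_mono1 Suc_leI add_less_mono1)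
  then have "(a * t + p') * t + p < t * t * t" using assms
    by (metis add.commute less_le_trans mult_Suc mult_le_mono1 Suc_leI add_less_mono1)
  then show "table_index t a p' p < t ^ 3" by (simp add: table_index_def power3_eq_cube)
qed

lemma table_index_less:
  assumes "p1 < t" "p1' < t" "a1 < a \<or> a1 = a \<and> (p1' < p' \<or> p1' = p' \<and> p1 < p)"
  shows "table_index t a1 p1' p1 < table_index t a p' p"
proof -
  have step: "x * t + y < x' * t + y'" if "y < t" "x < x'" for x x' y y' :: nat
  proof -
    have "x * t + y < Suc x * t" using that by simp
    also have "\<dots> \<le> x' * t" using that by (intro mult_le_mono1) simp
    finally show ?thesis by simp
  qed
  show ?thesis
  proof (cases "a1 * t + p1' < a * t + p'")
    case True
    then show ?thesis unfolding table_index_def using step assms by blast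
  next
    case False
    then have "a1 = a \<and> p1' = p' \<and> p1 < p" using assms step by auto
    then show ?thesis by (simp add: table_index_def)
  qed
qed

section \<open>Cube sums\<close>

text \<open>Only the summand for the top bit survives. For fixed \<open>b\<close> the rest is a
  quadratic polynomial in the bits of \<open>y\<close>.\<close>

lemma quad_form_top:
  assumes "top_bit b y" "b < t"
  shows "quad_form W t y = (\<Sum>p'<b. \<Sum>p<p'. bit_val p' y * bit_val p y * of_bool (hasbit (table_index t b p' p) W))"
proof -
  have "quad_form W t y = (\<Sum>a<t. if a = b
      then (\<Sum>p'<b. \<Sum>p<p'. bit_val p' y * bit_val p y * of_bool (hasbit (table_index t b p' p) W)) else 0)"
    unfolding quad_form_def
  proof (rule sum.cong)
    fix a
    show "(\<Sum>p'<a. \<Sum>p<p'. of_bool (top_bit a y \<and> hasbit p' y \<and> hasbit p y \<and> hasbit (table_index t a p' p) W)) =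
      (if a = b then (\<Sum>p'<b. \<Sum>p<p'. bit_val p' y * bit_val p y * of_bool (hasbit (table_index t b p' p) W)) else 0)"
    proof (cases "a = b")
      case True
      then show ?thesis using assms(1) by (simp add: bit_val_def of_bool_conj mult.assoc)
    next
      case False
      then have "\<not> top_bit a y" using assms(1) top_bit_unique by blast
      then show ?thesis using False by simp
    qed
  qed simp
  also have "\<dots> = (\<Sum>p'<b. \<Sum>p<p'. bit_val p' y * bit_val p y * of_bool (hasbit (table_index t b p' p) W))"
    using assms(2) by simp
  finally show ?thesis .
qed

lemma quad_form_0 [simp]: "quad_form W t 0 = 0"
  by (simp add: quad_form_def top_bit_def)

definition cube :: "nat \<Rightarrow> nat \<Rightarrow> nat \<Rightarrow> (nat \<Rightarrow> nat) \<Rightarrow> nat" where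
  "cube m m' m'' f = f 0 + f m + f m' + f (m + m') +
     f m'' + f (m + m'') + f (m' + m'') + f (m + m' + m'')"

lemma cube_sum: "cube m m' m'' (\<lambda>x. \<Sum>i\<in>I. f i x) = (\<Sum>i\<in>I. cube m m' m'' (f i))"
  by (simp add: cube_def sum.distrib)

lemma cube_add: "cube m m' m'' (\<lambda>x. f x + g x) = cube m m' m'' f + cube m m' m'' g"
  by (simp add: cube_def)

lemma cube_cong:
  assumes "\<And>x. x < s \<Longrightarrow> f x = g x" "m + m' + m'' < s"
  shows "cube m m' m'' f = cube m m' m'' g"
  using assms by (simp add: cube_def)

text \<open>All vertices \<open>x + r\<close> share the top bit of \<open>r\<close>, so one
  quadratic polynomial applies to them all. Its arguments are affine in the cube directions, and the
  third difference of a quadratic polynomial vanishes modulo 2.\<close>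

lemma even_cube_quad_form:
  assumes m: "m < 2 ^ s1" "2 ^ s1 dvd m'" "m + m' < 2 ^ s2" "2 ^ s2 dvd m''" "m + m' + m'' < 2 ^ s3"
    and r: "2 ^ s3 dvd r" "0 < r" "r < 2 ^ t"
  shows "even (cube m m' m'' (\<lambda>x. quad_form W t (x + r)))"
proof -
  obtain b where b: "top_bit b r" using top_bit_exists r(2) by blast
  have bt: "b < t" using top_bit_mono b r(3) by blast
  have quad_form: "quad_form W t (x + r) = (\<Sum>p'<b. \<Sum>p<p'. bit_val p' (x + r) * bit_val p (x + r) * of_bool (hasbit (table_index t b p' p) W))"
    if "x < 2 ^ s3" for x
    using quad_form_top[OF top_bit_add[OF that r(1) b] bt] .
  have i1: "bit_val p (m + m') = bit_val p m + bit_val p m'" for p using bit_val_add[OF m(1,2)] .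
  have i2: "bit_val p (m + m'') = bit_val p m + bit_val p m''" "bit_val p (m' + m'') = bit_val p m' + bit_val p m''"
    "bit_val p (m + m' + m'') = bit_val p m + bit_val p m' + bit_val p m''" for p
    using bit_val_add[OF _ m(4)] m(3) i1 by simp_all
  have i3: "bit_val p (x + r) = bit_val p x + bit_val p r" if "x \<le> m + m' + m''" for p x
    using bit_val_add[OF _ r(1)] that m(5) by simp
  have ev: "even (cube m m' m'' (\<lambda>x. bit_val p' (x + r) * bit_val p (x + r) * d))" for p' p d
  proof -
    \<comment> \<open>The \<open>c\<close> are values of bit \<open>p'\<close> and the
      \<open>d\<close> of bit \<open>p\<close>; subscript 0 belongs to \<open>r\<close>, subscripts
      1 to 3 to \<open>m\<close>, \<open>m'\<close>, \<open>m''\<close>.\<close>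
    have alg: "even ((c0 * d0 + (c1 + c0) * (d1 + d0) + (c2 + c0) * (d2 + d0) + (c1 + c2 + c0) * (d1 + d2 + d0) +
      (c3 + c0) * (d3 + d0) + (c1 + c3 + c0) * (d1 + d3 + d0) + (c2 + c3 + c0) * (d2 + d3 + d0)
      + (c1 + c2 + c3 + c0) * (d1 + d2 + d3 + d0)))" (is "even ?s") for c0 c1 c2 c3 d0 d1 d2 d3 :: nat
    proof -
      have "?s = 2 * (4 * c0 * d0 + 2 * c0 * (d1 + d2 + d3) + 2 * d0 * (c1 + c2 + c3)
        + 2 * (c1 * d1 + c2 * d2 + c3 * d3) + c1 * d2 + c2 * d1 + c1 * d3 + c3 * d1 + c2 * d3 + c3 * d2)"
        by algebra
      then show ?thesis by (rule dvdI)
    qed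
    have "cube m m' m'' (\<lambda>x. bit_val p' (x + r) * bit_val p (x + r) * d) = cube m m' m'' (\<lambda>x. bit_val p' (x + r) * bit_val p (x + r)) * d"
      by (simp add: cube_def distrib_right)
    moreover have "even (cube m m' m'' (\<lambda>x. bit_val p' (x + r) * bit_val p (x + r)))"
      unfolding cube_def
      using alg[of "bit_val p' r" "bit_val p r" "bit_val p' m" "bit_val p m" "bit_val p' m'" "bit_val p m'" "bit_val p' m''" "bit_val p m''"]
      by (simp add: i3 i2 i1)
    ultimately show ?thesis by simp
  qed
  have "cube m m' m'' (\<lambda>x. quad_form W t (x + r)) =
    cube m m' m'' (\<lambda>x. \<Sum>p'<b. \<Sum>p<p'. bit_val p' (x + r) * bit_val p (x + r) * of_bool (hasbit (table_index t b p' p) W))"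
    by (rule cube_cong[OF _ m(5)]) (rule quad_form)
  also have "even \<dots>"
    unfolding cube_sum by (intro dvd_sum ev)
  finally show ?thesis .
qed

text \<open>The four vertices containing \<open>m''\<close> have top bit \<open>a\<close>, so their
  sum is a second difference in the directions \<open>m\<close> and \<open>m'\<close>. It leaves the
  mixed products, of which those with the higher bit in \<open>m\<close> vanish because
  \<open>m\<close> lies below \<open>m'\<close>.\<close>

lemma cube_quad_form:
  assumes m: "m < 2 ^ s1" "2 ^ s1 dvd m'" "m + m' < 2 ^ s2" "2 ^ s2 dvd m''"
    and a: "top_bit a m''" "a < t"
  shows "even (cube m m' m'' (quad_form W t) + defect W t a m m')"
proof -
  have s2: "s2 \<le> a" using hasbit_ge[OF top_bit_hasbit[OF a(1)] m(4)] .
  have quad_form: "quad_form W t (x + m'') = (\<Sum>p'<a. \<Sum>p<p'. bit_val p' (x + m'') * bit_val p (x + m'') * of_bool (hasbit (table_index t a p' p) W))"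
    if "x < 2 ^ s2" for x
    using quad_form_top[OF top_bit_add[OF that m(4) a(1)] a(2)] .
  have i1: "bit_val p (m + m') = bit_val p m + bit_val p m'" for p using bit_val_add[OF m(1,2)] .
  have i2: "bit_val p (x + m'') = bit_val p x + bit_val p m''" if "x \<le> m + m'" for p x
    using bit_val_add[OF _ m(4)] m(3) that by simp
  let ?d = "\<lambda>p' p. of_bool (hasbit (table_index t a p' p) W)"
  have bits: "q < s1" if "hasbit q m" for q using that hasbit_lt m(1) by blast
  have bits': "s1 \<le> q" "q < a" if "hasbit q m'" for q
    using that hasbit_ge[of q m' s1] hasbit_lt[of q m' s2] m(2,3) s2 by simp_all
  \<comment> \<open>The square of indices shrinks to a triangle: bits of \<open>m\<close> are below
    \<open>s1\<close>, bits of \<open>m'\<close> are between \<open>s1\<close> and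
    \<open>a\<close>.\<close>
  have cross_form: "cross_form W t a m m' = (\<Sum>p'<a. \<Sum>p<p'. bit_val p' m' * bit_val p m * ?d p' p)"
  proof -
    have "cross_form W t a m m' = (\<Sum>q'<t. \<Sum>q<t. bit_val q' m' * bit_val q m * ?d q' q)"
      unfolding cross_form_def by (subst sum.swap) (simp add: bit_val_def of_bool_conj mult_ac)
    also have "\<dots> = (\<Sum>q'<a. \<Sum>q<t. bit_val q' m' * bit_val q m * ?d q' q)"
    proof (rule sum.mono_neutral_right)
      show "{..<a} \<subseteq> {..<t}" using a(2) by auto
      show "\<forall>i\<in>{..<t} - {..<a}. (\<Sum>q<t. bit_val i m' * bit_val q m * ?d i q) = 0"
      proof
        fix i assume "i \<in> {..<t} - {..<a}"
        then have "\<not> hasbit i m'" using bits'(2)[of i] by auto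
        then show "(\<Sum>q<t. bit_val i m' * bit_val q m * ?d i q) = 0" by (simp add: bit_val_def)
      qed
    qed simp
    also have "\<dots> = (\<Sum>p'<a. \<Sum>p<p'. bit_val p' m' * bit_val p m * ?d p' p)"
    proof (rule sum.cong[OF refl], rule sum.mono_neutral_right)
      fix q' assume "q' \<in> {..<a}"
      then show "{..<q'} \<subseteq> {..<t}" using a(2) by auto
      show "\<forall>i\<in>{..<t} - {..<q'}. bit_val q' m' * bit_val i m * ?d q' i = 0"
        using bits bits'(1)[of q'] by (force simp: bit_val_def)
    qed simp
    finally show ?thesis .
  qed
  have ev: "even (bit_val p' m'' * bit_val p m'' * d + bit_val p' (m + m'') * bit_val p (m + m'') * d + bit_val p' (m' + m'') * bit_val p (m' + m'') * d
     + bit_val p' (m + m' + m'') * bit_val p (m + m' + m'') * d + bit_val p' m' * bit_val p m * d)" if "p < p'" for p' p d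
  proof -
    have "bit_val p' m * bit_val p m' = 0" using bits[of p'] bits'(1)[of p] that by (auto simp: bit_val_def)
    then show ?thesis by (auto simp: i1 i2)
  qed
  have quad_form': "quad_form W t (x + m'') = (\<Sum>p'<a. \<Sum>p<p'. bit_val p' (x + m'') * bit_val p (x + m'') * ?d p' p)"
    if "x \<in> {0, m, m', m + m'}" for x
    using quad_form[of x] that m(3) by auto
  have "even (quad_form W t (0 + m'') + quad_form W t (m + m'') + quad_form W t (m' + m'') + quad_form W t (m + m' + m'') + cross_form W t a m m')"
    unfolding quad_form'[of 0, OF insertI1] quad_form'[of m, OF insertI2, OF insertI1] quad_form'[of m', OF insertI2, OF insertI2, OF insertI1]
      quad_form'[of "m + m'", OF insertI2, OF insertI2, OF insertI2, OF insertI1] cross_form sum.distrib[symmetric]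
    by (intro dvd_sum, unfold add_0, rule ev) simp
  \<comment> \<open>The values at \<open>m\<close>, \<open>m'\<close> and \<open>m + m'\<close>
    occur both in the cube and in \<open>defect\<close>, and so cancel modulo 2; the value at 0 is
    0.\<close>
  then show ?thesis unfolding cube_def defect_def by (simp, argo)
qed

text \<open>A bit \<open>t\<close> of \<open>n\<close> sees the same lower bits as in
  \<open>n\<close> alone, while a bit \<open>t\<close> of \<open>k\<close> sees all of
  \<open>n\<close> and the part of \<open>k\<close> below \<open>t\<close>.\<close>

lemma coloring_add:
  assumes n: "n < 2 ^ s" and k: "2 ^ s dvd k"
  shows "even (coloring (n + k) + coloring n + (\<Sum>t\<in>set_decode k. quad_form (table t (t ^ 3)) t (n + k mod 2 ^ t)))"
proof -
  have coloring: "even (coloring x + (\<Sum>t\<in>set_decode x. quad_form (table t (t ^ 3)) t (x mod 2 ^ t)))" for x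
  proof -
    have "(\<Sum>t<x. if hasbit t x then quad_form (table t (t ^ 3)) t (x mod 2 ^ t) else 0) =
      (\<Sum>t\<in>{..<x} \<inter> {t. hasbit t x}. quad_form (table t (t ^ 3)) t (x mod 2 ^ t))"
      by (simp add: sum.If_cases)
    also have "{..<x} \<inter> {t. hasbit t x} = set_decode x"
      using hasbit_less by (auto simp flip: hasbit_iff_set_decode)
    finally show ?thesis by (simp add: coloring_def)
  qed
  have dec: "set_decode (n + k) = set_decode n \<union> set_decode k"
    using hasbit_add[OF n k] by (auto simp flip: hasbit_iff_set_decode)
  have disj: "set_decode n \<inter> set_decode k = {}"
    using hasbit_lt[OF _ n] hasbit_ge[OF _ k] by (force simp flip: hasbit_iff_set_decode)
  have 1: "(n + k) mod 2 ^ t = n mod 2 ^ t" if "t \<in> set_decode n" for t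
  proof -
    have "2 ^ t dvd k"
      using that hasbit_lt[OF _ n] k by (meson dvd_trans hasbit_iff_set_decode le_imp_power_dvd less_imp_le)
    then show ?thesis by (metis add.right_neutral dvd_eq_mod_eq_0 mod_add_right_eq)
  qed
  have 2: "(n + k) mod 2 ^ t = n + k mod 2 ^ t" if "t \<in> set_decode k" for t
  proof -
    have st: "s \<le> t" using that hasbit_ge[OF _ k] by (simp add: hasbit_iff_set_decode)
    then have p: "(2::nat) ^ t = 2 ^ s * 2 ^ (t - s)" by (simp flip: power_add)
    have "2 ^ s dvd k mod 2 ^ t" using k p by (simp add: dvd_mod)
    then obtain q where q: "k mod 2 ^ t = 2 ^ s * q" by auto
    have "k mod 2 ^ t < 2 ^ t" by simp
    then have "2 ^ s * q < 2 ^ s * 2 ^ (t - s)" unfolding q by (simp only: p)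
    then have "q < 2 ^ (t - s)" by simp
    then have "2 ^ s * Suc q \<le> 2 ^ s * 2 ^ (t - s)" by (intro mult_le_mono2) simp
    then have "n + k mod 2 ^ t < 2 ^ t" using n unfolding q by (simp add: p)
    then have "(n + k mod 2 ^ t) mod 2 ^ t = n + k mod 2 ^ t" by simp
    then show ?thesis by (simp add: mod_add_right_eq)
  qed
  have "(\<Sum>t\<in>set_decode (n + k). quad_form (table t (t ^ 3)) t ((n + k) mod 2 ^ t)) =
    (\<Sum>t\<in>set_decode n. quad_form (table t (t ^ 3)) t (n mod 2 ^ t)) + (\<Sum>t\<in>set_decode k. quad_form (table t (t ^ 3)) t (n + k mod 2 ^ t))"
    unfolding dec using disj 1 2 by (simp add: sum.union_disjoint)
  then show ?thesis using coloring[of "n + k"] coloring[of n] by auto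
qed

lemma coloring_0 [simp]: "coloring 0 = 0"
  by (simp add: coloring_def)

text \<open>Summing \<open>coloring_add\<close> over the cube, the colours contribute 15 times
  \<open>\<gamma>\<close>, which has the parity of \<open>\<gamma>\<close>. At a bit
  \<open>t > \<tau>\<close> the part of \<open>k\<close> below \<open>t\<close> is nonzero, so
  \<open>even_cube_quad_form\<close> applies. The lowest bit \<open>\<tau>\<close> sees nothing of
  \<open>k\<close> and contributes the bare cube, that is, the defect.\<close>

lemma even_defect:
  assumes m: "m < 2 ^ s1" "2 ^ s1 dvd m'" "m + m' < 2 ^ s2" "2 ^ s2 dvd m''" "m + m' + m'' < 2 ^ s3"
    and a: "top_bit a m''" "a < \<tau>"
    and k: "2 ^ s3 dvd k" "hasbit \<tau> k" "2 ^ \<tau> dvd k"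
    and g: "cube m m' m'' (\<lambda>x. coloring (x + k)) = 8 * \<gamma>" "cube m m' m'' coloring = 7 * \<gamma>"
  shows "even (\<gamma> + defect (table \<tau> (\<tau> ^ 3)) \<tau> a m m')"
proof -
  let ?T = "\<lambda>t x. quad_form (table t (t ^ 3)) t x"
  let ?B = "\<lambda>x. \<Sum>t\<in>set_decode k. ?T t (x + k mod 2 ^ t)"
  have 1: "even (coloring (x + k) + coloring x + ?B x)" if "x \<le> m + m' + m''" for x
    using coloring_add[OF _ k(1), of x] that m(5) by simp
  have "even (cube m m' m'' (\<lambda>x. coloring (x + k) + coloring x + ?B x))"
    unfolding cube_def by (intro dvd_add 1) simp_all
  then have 2: "even (\<gamma> + cube m m' m'' ?B)"
    unfolding cube_add g by simp
  have \<tau>: "\<tau> \<in> set_decode k" using k(2) by (simp add: hasbit_iff_set_decode)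
  have "cube m m' m'' ?B = (\<Sum>t\<in>set_decode k. cube m m' m'' (\<lambda>x. ?T t (x + k mod 2 ^ t)))"
    by (rule cube_sum)
  also have "\<dots> = cube m m' m'' (\<lambda>x. ?T \<tau> (x + k mod 2 ^ \<tau>)) +
      (\<Sum>t\<in>set_decode k - {\<tau>}. cube m m' m'' (\<lambda>x. ?T t (x + k mod 2 ^ t)))"
    using \<tau> by (intro sum.remove) simp_all
  also have "(\<lambda>x. ?T \<tau> (x + k mod 2 ^ \<tau>)) = ?T \<tau>"
    using k(3) by (simp add: dvd_eq_mod_eq_0 del: mod_eq_0_iff_dvd)
  finally have 3: "cube m m' m'' ?B = cube m m' m'' (?T \<tau>) +
      (\<Sum>t\<in>set_decode k - {\<tau>}. cube m m' m'' (\<lambda>x. ?T t (x + k mod 2 ^ t)))" .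
  have 4: "even (\<Sum>t\<in>set_decode k - {\<tau>}. cube m m' m'' (\<lambda>x. ?T t (x + k mod 2 ^ t)))"
  proof (intro dvd_sum even_cube_quad_form[OF m])
    fix t assume t: "t \<in> set_decode k - {\<tau>}"
    then have ht: "hasbit t k" by (simp add: hasbit_iff_set_decode)
    have "\<tau> < t" using hasbit_ge[OF ht k(3)] t by auto
    show "2 ^ s3 dvd k mod 2 ^ t"
      using k(1) hasbit_ge[OF ht k(1)] by (simp add: dvd_mod le_imp_power_dvd)
    show "k mod 2 ^ t < 2 ^ t" by simp
    have "\<not> 2 ^ t dvd k" using hasbit_ge[OF k(2)] \<open>\<tau> < t\<close> by (meson not_le)
    then show "0 < k mod 2 ^ t" by (simp add: dvd_eq_mod_eq_0)
  qed
  have 5: "even (cube m m' m'' (?T \<tau>) + defect (table \<tau> (\<tau> ^ 3)) \<tau> a m m')"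
    using cube_quad_form[OF m(1-4) a] .
  have "even (g + d)" if "even (g + b)" "b = x + y" "even y" "even (x + d)" for g b d x y :: nat
    using that by simp
  from this[OF 2 3 4 5] show ?thesis .
qed

section \<open>Limits of the approximations\<close>

text \<open>\<open>table_bit\<close> fixed entry \<open>s\<close> with only the earlier table
  \<open>W0\<close> at hand. All other entries relevant to the defect precede \<open>s\<close>, and
  \<open>s\<close> itself occurs once, at the pair of top bits, so passing from \<open>W0\<close> to
  \<open>W\<close> adds exactly that entry.\<close>

lemma odd_defect:
  assumes p: "p < p'" "p' < a" "a < t"
    and m: "top_bit p m" "top_bit p' m'" "2 ^ Suc p dvd m'"
    and selected: "m = code_sum (selected_low p p' a t)" "m' = code_sum (selected_high p p' a t)"
  shows "odd (served p p' a t + defect (table t (t ^ 3)) t a m m')"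
proof -
  define s where "s = table_index t a p' p"
  define W where "W = table t (t ^ 3)"
  define W0 where "W0 = table t s"
  have s: "s < t ^ 3" "s div (t * t) = a" "s div t mod t = p'" "s mod t = p"
    unfolding s_def using table_index_decode[of a t p' p] p by simp_all
  have W_s: "hasbit s W \<longleftrightarrow>
     even (served p p' a t + defect W0 t a m m')"
    unfolding W_def hasbit_table using s by (simp add: table_bit_def selected W0_def)
  have W0_s: "\<not> hasbit s W0" unfolding W0_def hasbit_table by simp
  have W_less: "hasbit j W \<longleftrightarrow> hasbit j W0" if "j < s" for j
    unfolding W_def W0_def hasbit_table using that s(1) by simp
  \<comment> \<open>Arguments below \<open>2 ^ a\<close> have top bit below \<open>a\<close>, so
    only entries with a smaller leading digit are consulted.\<close>
  have quad_form: "quad_form W t x = quad_form W0 t x" if x: "x < 2 ^ a" for x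
    unfolding quad_form_def
  proof (intro sum.cong refl)
    fix a1 p1' p1 assume *: "a1 \<in> {..<t}" "p1' \<in> {..<a1}" "p1 \<in> {..<p1'}"
    show "of_bool (top_bit a1 x \<and> hasbit p1' x \<and> hasbit p1 x \<and> hasbit (table_index t a1 p1' p1) W) =
      (of_bool (top_bit a1 x \<and> hasbit p1' x \<and> hasbit p1 x \<and> hasbit (table_index t a1 p1' p1) W0) :: nat)"
    proof (cases "top_bit a1 x")
      case True
      then have "a1 < a" using top_bit_mono x by blast
      then have "table_index t a1 p1' p1 < s" unfolding s_def using * by (intro table_index_less) auto
      then show ?thesis using W_less by simp
    qed simp
  qed
  have m_lt: "m < 2 ^ Suc p" "m' < 2 ^ Suc p'" using m unfolding top_bit_def by simp_all
  have sum: "top_bit p' (m + m')" using top_bit_add[OF m_lt(1) m(3,2)] .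
  have le: "(2::nat) ^ Suc p' \<le> 2 ^ a" using p(2) by (intro power_increasing) simp_all
  have lt: "m < 2 ^ a" "m' < 2 ^ a" "m + m' < 2 ^ a"
    using sum le unfolding top_bit_def by linarith+
  let ?f = "\<lambda>W (q, q'). of_bool (hasbit q m \<and> hasbit q' m' \<and> hasbit (table_index t a q' q) W) :: nat"
  let ?I = "{..<t} \<times> {..<t}"
  have cross_form: "cross_form V t a m m' = ?f V (p, p') + sum (?f V) (?I - {(p, p')})" for V
  proof -
    have "cross_form V t a m m' = sum (?f V) ?I" unfolding cross_form_def by (rule sum.cartesian_product)
    also have "\<dots> = ?f V (p, p') + sum (?f V) (?I - {(p, p')})"
      by (rule sum.remove) (use p in auto)
    finally show ?thesis .
  qed
  \<comment> \<open>As \<open>p\<close> and \<open>p'\<close> are top bits, every other pair of bits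
    \<open>(q', q)\<close> is lexicographically smaller than \<open>(p', p)\<close>.\<close>
  have rest: "sum (?f W) (?I - {(p, p')}) = sum (?f W0) (?I - {(p, p')})"
  proof (rule sum.cong[OF refl])
    fix z assume z: "z \<in> ?I - {(p, p')}"
    obtain q q' where [simp]: "z = (q, q')" by (cases z)
    show "?f W z = ?f W0 z"
    proof (cases "hasbit q m \<and> hasbit q' m'")
      case True
      then have "q < Suc p" "q' < Suc p'" using hasbit_lt m_lt by blast+
      then have "q' < p' \<or> q' = p' \<and> q < p" using z by auto
      then have "table_index t a q' q < s" unfolding s_def using z by (intro table_index_less) auto
      then show ?thesis using W_less by simp
    qed auto
  qed
  have "cross_form W t a m m' = cross_form W0 t a m m' + of_bool (hasbit s W)"
    using top_bit_hasbit[OF m(1)] top_bit_hasbit[OF m(2)] W0_s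
    by (simp add: cross_form rest flip: s_def)
  then have "defect W t a m m' = defect W0 t a m m' + of_bool (hasbit s W)"
    using lt by (simp add: defect_def quad_form)
  then show ?thesis unfolding W_def[symmetric] using W_s by auto
qed

lemma code_sum_eq: "code_sum F = \<Sum>(set_decode F)"
proof -
  have "code_sum F = (\<Sum>f\<in>{..<F} \<inter> {f. hasbit f F}. f)" by (simp add: code_sum_def sum.If_cases)
  also have "{..<F} \<inter> {f. hasbit f F} = set_decode F"
    using hasbit_less by (auto simp flip: hasbit_iff_set_decode)
  finally show ?thesis .
qed

lemma le_code_sum: "f \<in> set_decode F \<Longrightarrow> f \<le> code_sum F"
  unfolding code_sum_eq by (rule member_le_sum) simp_all

lemma code_less:
  assumes "\<And>f. f \<in> set_decode F \<Longrightarrow> f < n"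
  shows "F < 2 ^ n"
proof -
  have "F = set_encode (set_decode F)" by simp
  also have "\<dots> \<le> (\<Sum>i<n. 2 ^ i)" unfolding set_encode_def
    by (rule sum_mono2) (use assms in auto)
  also have "\<dots> < 2 ^ n" by (induction n) auto
  finally show ?thesis .
qed

lemma code_less_if_code_sum: "code_sum F < n \<Longrightarrow> F < 2 ^ n"
  using le_code_sum by (intro code_less) (meson le_less_trans)

section \<open>Levels in the limit\<close>

definition index_set :: "nat \<Rightarrow> nat set" where
  "index_set e = {n. \<forall>x. \<exists>y. \<forall>t. unrefuted (e div 2) n x y t}"

definition limit_level :: "nat \<Rightarrow> nat \<Rightarrow> nat \<Rightarrow> nat" where
  "limit_level e F a = (\<Sum>u<a. of_bool (\<forall>f\<in>set_decode F. \<forall>x\<le>u. \<exists>y<a. \<forall>t. unrefuted (e div 2) f x y t))"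

text \<open>Only finitely many instances of \<open>unrefuted\<close> are involved, and each can
  change only once, from true to false.\<close>

lemma stage_level_limit: "\<forall>\<^sub>F t in sequentially. stage_level e F a t = limit_level e F a"
proof -
  have "\<forall>\<^sub>F t in sequentially. \<forall>z\<in>{..<F} \<times> {..<a} \<times> {..<a}.
      case z of (f, x, y) \<Rightarrow> unrefuted (e div 2) f x y t \<longleftrightarrow> (\<forall>t. unrefuted (e div 2) f x y t)"
  proof (intro eventually_ball_finite ballI)
    fix z :: "nat \<times> nat \<times> nat"
    obtain f x y where z: "z = (f, x, y)" by (cases z)
    show "\<forall>\<^sub>F t in sequentially. case z of (f, x, y) \<Rightarrow>
        unrefuted (e div 2) f x y t \<longleftrightarrow> (\<forall>t. unrefuted (e div 2) f x y t)"
    proof (cases "\<forall>t. unrefuted (e div 2) f x y t")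
      case False
      then obtain N where "\<not> unrefuted (e div 2) f x y N" by blast
      then have "\<forall>t\<ge>N. \<not> unrefuted (e div 2) f x y t" using unrefuted_antimono by blast
      then show ?thesis unfolding z using False by (auto simp: eventually_sequentially)
    qed (simp add: z)
  qed simp
  then show ?thesis
  proof eventually_elim
    case (elim t)
    have 1: "unrefuted (e div 2) f x y t \<longleftrightarrow> (\<forall>t. unrefuted (e div 2) f x y t)"
      if "f < F" "x < a" "y < a" for f x y using elim that by auto
    have 2: "(\<forall>f<F. hasbit f F \<longrightarrow> Q f) \<longleftrightarrow> (\<forall>f\<in>set_decode F. f < F \<longrightarrow> Q f)" for Q
      by (auto simp: hasbit_iff_set_decode)
    have 3: "f < F" if "f \<in> set_decode F" for f
      using that hasbit_less by (simp flip: hasbit_iff_set_decode)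
    show ?case
      unfolding stage_level_def limit_level_def 2
    proof (intro sum.cong refl arg_cong[of _ _ of_bool] ball_cong)
      fix u f assume u: "u \<in> {..<a}" and f: "f \<in> set_decode F"
      show "(f < F \<longrightarrow> (\<forall>x\<le>u. \<exists>y<a. unrefuted (e div 2) f x y t)) \<longleftrightarrow>
          (\<forall>x\<le>u. \<exists>y<a. \<forall>t. unrefuted (e div 2) f x y t)"
        using 1[of f] 3[OF f] u by (metis le_less_trans lessThan_iff)
    qed
  qed
qed

lemma eventually_all_less:
  fixes N :: nat
  assumes "\<And>i. i < N \<Longrightarrow> eventually (P i) net"
  shows "eventually (\<lambda>t. \<forall>i<N. P i t) net"
proof -
  have "eventually (\<lambda>t. \<forall>i\<in>{..<N}. P i t) net"
    by (rule eventually_ball_finite) (use assms in auto)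
  then show ?thesis by (rule eventually_mono) auto
qed

lemma stage_level_limit_finite: "\<forall>\<^sub>F t in sequentially. \<forall>F<N. stage_level e F a t = limit_level e F a"
  by (rule eventually_all_less) (rule stage_level_limit)

lemma limit_level_mono: "a \<le> b \<Longrightarrow> limit_level e F a \<le> limit_level e F b"
proof -
  assume ab: "a \<le> b"
  have "limit_level e F a \<le> (\<Sum>u<a. of_bool (\<forall>f\<in>set_decode F. \<forall>x\<le>u. \<exists>y<b. \<forall>t. unrefuted (e div 2) f x y t))"
    unfolding limit_level_def
  proof (rule sum_mono)
    fix u
    have "\<forall>f\<in>set_decode F. \<forall>x\<le>u. \<exists>y<b. \<forall>t. unrefuted (e div 2) f x y t"
      if "\<forall>f\<in>set_decode F. \<forall>x\<le>u. \<exists>y<a. \<forall>t. unrefuted (e div 2) f x y t"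
      using that ab by (meson less_le_trans)
    then show "of_bool (\<forall>f\<in>set_decode F. \<forall>x\<le>u. \<exists>y<a. \<forall>t. unrefuted (e div 2) f x y t)
      \<le> (of_bool (\<forall>f\<in>set_decode F. \<forall>x\<le>u. \<exists>y<b. \<forall>t. unrefuted (e div 2) f x y t) :: nat)"
      unfolding of_bool_less_eq_iff by (rule impI)
  qed
  also have "\<dots> \<le> limit_level e F b"
    unfolding limit_level_def by (rule sum_mono2) (use ab in auto)
  finally show ?thesis .
qed

text \<open>An element outside the set fails at some \<open>x\<close> for every witness
  \<open>y\<close>, so no \<open>u \<ge> x\<close> is ever counted.\<close>

lemma limit_level_bounded:
  assumes "\<not> set_decode F \<subseteq> index_set e"
  shows "\<exists>K. \<forall>a. limit_level e F a \<le> K"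
proof -
  obtain f x where f: "f \<in> set_decode F" "\<And>y. \<not> (\<forall>t. unrefuted (e div 2) f x y t)"
    using assms unfolding index_set_def by blast
  have "limit_level e F a \<le> x" for a
  proof -
    have "limit_level e F a \<le> (\<Sum>u<a. of_bool (u < x))"
      unfolding limit_level_def
    proof (rule sum_mono)
      fix u
      show "of_bool (\<forall>f\<in>set_decode F. \<forall>x\<le>u. \<exists>y<a. \<forall>t. unrefuted (e div 2) f x y t) \<le> (of_bool (u < x) :: nat)"
        using f by (cases "u < x") (auto simp: not_less)
    qed
    also have "\<dots> = card ({..<a} \<inter> {u. u < x})" by simp
    also have "\<dots> \<le> card {..<x}" by (rule card_mono) auto
    finally show ?thesis by simp
  qed
  then show ?thesis by blast
qed

lemma limit_level_unbounded:
  assumes "set_decode F \<subseteq> index_set e"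
  shows "\<forall>\<^sub>F a in sequentially. K < limit_level e F a"
proof -
  have "\<forall>z. \<exists>y. fst z \<in> set_decode F \<longrightarrow> (\<forall>t. unrefuted (e div 2) (fst z) (snd z) y t)"
    using assms unfolding index_set_def by blast
  then obtain Y where Y: "\<And>f x t. f \<in> set_decode F \<Longrightarrow> unrefuted (e div 2) f x (Y (f, x)) t"
    by (metis fst_conv snd_conv)
  \<comment> \<open>\<open>N\<close> leaves room for the levels up to \<open>K\<close> and exceeds
    the witnesses of all the finitely many instances they involve.\<close>
  define N where "N = Suc K + (\<Sum>z\<in>set_decode F \<times> {..K}. Suc (Y z))"
  have YN: "Y (f, x) < N" if "f \<in> set_decode F" "x \<le> K" for f x
  proof -
    have "Suc (Y (f, x)) \<le> (\<Sum>z\<in>set_decode F \<times> {..K}. Suc (Y z))"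
      by (rule member_le_sum) (use that in auto)
    then show ?thesis by (simp add: N_def)
  qed
  have "K < limit_level e F a" if a: "N \<le> a" for a
  proof -
    have "Suc K = (\<Sum>u<Suc K. of_bool (\<forall>f\<in>set_decode F. \<forall>x\<le>u. \<exists>y<a. \<forall>t. unrefuted (e div 2) f x y t))"
    proof -
      have "\<forall>f\<in>set_decode F. \<forall>x\<le>u. \<exists>y<a. \<forall>t. unrefuted (e div 2) f x y t" if "u < Suc K" for u
        using Y YN a that by (meson less_Suc_eq_le less_le_trans order_trans)
      then show ?thesis by simp
    qed
    also have "\<dots> \<le> limit_level e F a"
      unfolding limit_level_def by (rule sum_mono2) (use a in \<open>auto simp: N_def\<close>)
    finally show ?thesis by simp
  qed
  then show ?thesis unfolding eventually_sequentially by blast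
qed

text \<open>The level is monotone in \<open>a\<close> and bounded, so it reaches its maximum and
  stays there.\<close>

lemma limit_level_false_const:
  assumes "\<not> set_decode F \<subseteq> index_set e"
  shows "\<forall>\<^sub>F b in sequentially. \<forall>a\<ge>b. limit_level e F a = limit_level e F b"
proof -
  obtain K where K: "\<And>a. limit_level e F a \<le> K" using limit_level_bounded[OF assms] by blast
  define m where "m = Max (range (limit_level e F))"
  have fin: "finite (range (limit_level e F))" by (rule finite_subset[of _ "{..K}"]) (use K in auto)
  have "m \<in> range (limit_level e F)" unfolding m_def using fin by (intro Max_in) auto
  then obtain N where N: "limit_level e F N = m" by auto
  have le: "limit_level e F a \<le> m" for a unfolding m_def using fin by (intro Max_ge) auto
  have "limit_level e F a = m" if "N \<le> a" for a using limit_level_mono[OF that, of e F] le[of a] N by simp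
  then show ?thesis unfolding eventually_sequentially by (metis order_trans)
qed

section \<open>Assignment of positions to indices\<close>

definition attained :: "nat \<Rightarrow> nat \<Rightarrow> bool" where
  "attained e p \<longleftrightarrow> (\<exists>F. top_bit p (code_sum F) \<and> set_decode F \<subseteq> index_set e)"

text \<open>If \<open>p\<close> is attained, some level is unbounded and passes its value at
  \<open>p'\<close> for large \<open>a\<close>. Otherwise the finitely many levels in question are
  all constant beyond a large \<open>p'\<close>. In both cases large \<open>t\<close> makes the
  stages agree with their limits.\<close>

lemma rises_limit:
  "\<forall>\<^sub>F p' in sequentially. \<forall>\<^sub>F a in sequentially. \<forall>\<^sub>F t in sequentially. rises e p p' a t \<longleftrightarrow> attained e p"
proof (cases "attained e p")
  case True
  then obtain F where F: "top_bit p (code_sum F)" "set_decode F \<subseteq> index_set e" unfolding attained_def by blast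
  have F_less: "F < 2 ^ 2 ^ Suc p" using code_less_if_code_sum[of F "2 ^ Suc p"] F(1) unfolding top_bit_def by blast
  have "\<forall>\<^sub>F a in sequentially. \<forall>\<^sub>F t in sequentially. rises e p p' a t \<longleftrightarrow> attained e p" for p'
    using limit_level_unbounded[OF F(2), of "limit_level e F p'"]
  proof eventually_elim
    case (elim a)
    show ?case using stage_level_limit[of e F a] stage_level_limit[of e F p']
    proof eventually_elim
      case (elim t)
      then have "rises e p p' a t"
        unfolding rises_def using F(1) F_less \<open>limit_level e F p' < limit_level e F a\<close> by (intro exI[of _ F]) simp
      then show ?case using True by simp
    qed
  qed
  then show ?thesis by simp
next
  case False
  have "\<forall>\<^sub>F p' in sequentially. \<forall>F<2 ^ 2 ^ Suc p. top_bit p (code_sum F) \<longrightarrow> (\<forall>a\<ge>p'. limit_level e F a = limit_level e F p')"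
  proof (rule eventually_all_less)
    fix F
    show "\<forall>\<^sub>F p' in sequentially. top_bit p (code_sum F) \<longrightarrow> (\<forall>a\<ge>p'. limit_level e F a = limit_level e F p')"
    proof (cases "top_bit p (code_sum F)")
      case True
      then have "\<not> set_decode F \<subseteq> index_set e" using False unfolding attained_def by blast
      from limit_level_false_const[OF this] show ?thesis by (rule eventually_mono) blast
    qed simp
  qed
  then show ?thesis
  proof eventually_elim
    case (elim p')
    show ?case using eventually_ge_at_top[of p']
    proof eventually_elim
      case (elim a)
      show ?case using stage_level_limit_finite[of "2 ^ 2 ^ Suc p" e a] stage_level_limit_finite[of "2 ^ 2 ^ Suc p" e p']
      proof eventually_elim
        case (elim t)
        then have "\<not> rises e p p' a t"
          unfolding rises_def
          using \<open>\<forall>F<2 ^ 2 ^ Suc p. top_bit p (code_sum F) \<longrightarrow> (\<forall>a\<ge>p'. limit_level e F a = limit_level e F p')\<close> \<open>p' \<le> a\<close>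
          by (metis less_irrefl)
        then show ?case using False by simp
      qed
    qed
  qed
qed

text \<open>The limit of \<open>eligible\<close>: an index claims its first \<open>2 ^ e\<close>
  attained positions from \<open>e\<close> on.\<close>

definition elected :: "nat \<Rightarrow> nat \<Rightarrow> bool" where
  "elected e p \<longleftrightarrow> e \<le> p \<and> attained e p \<and> card {q. q < p \<and> e \<le> q \<and> attained e q} < 2 ^ e"

text \<open>The decision depends on \<open>rises\<close> for finitely many indices and positions up
  to \<open>P\<close>, so at each of the three levels the limits hold simultaneously.\<close>

lemma served_limit:
  assumes "elected e P" "\<And>e'. e' < e \<Longrightarrow> \<not> elected e' P"
  shows "\<forall>\<^sub>F p' in sequentially. \<forall>\<^sub>F a in sequentially. \<forall>\<^sub>F t in sequentially. served P p' a t = e"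
proof -
  have "\<forall>\<^sub>F p' in sequentially. \<forall>e'<Suc P. \<forall>q<Suc P. \<forall>\<^sub>F a in sequentially. \<forall>\<^sub>F t in sequentially.
      rises e' q p' a t \<longleftrightarrow> attained e' q"
    by (intro eventually_all_less rises_limit)
  then show ?thesis
  proof (eventually_elim)
    case (elim p')
    then have "\<forall>\<^sub>F a in sequentially. \<forall>e'<Suc P. \<forall>q<Suc P. \<forall>\<^sub>F t in sequentially.
      rises e' q p' a t \<longleftrightarrow> attained e' q"
      by (intro eventually_all_less) blast
    then show ?case
    proof eventually_elim
      case (elim a)
      then have "\<forall>\<^sub>F t in sequentially. \<forall>e'<Suc P. \<forall>q<Suc P. rises e' q p' a t \<longleftrightarrow> attained e' q"
        by (intro eventually_all_less) blast
      then show ?case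
      proof eventually_elim
        case (elim t)
        have eligible: "eligible e' P p' a t \<longleftrightarrow> elected e' P" if "e' \<le> P" for e'
        proof -
          have "(\<Sum>p1<P. of_bool (e' \<le> p1 \<and> rises e' p1 p' a t)) =
            (\<Sum>p1<P. of_bool (e' \<le> p1 \<and> attained e' p1) :: nat)"
            using elim that by (intro sum.cong) auto
          also have "\<dots> = card {q. q < P \<and> e' \<le> q \<and> attained e' q}"
            by (simp add: Int_def)
          finally show ?thesis unfolding eligible_def elected_def using elim that by simp
        qed
        have "e \<le> P" using assms(1) by (simp add: elected_def)
        then show ?case unfolding served_def using assms eligible by (intro bleast_eqI) auto
      qed
    qed
  qed
qed

text \<open>The rank of an element, the number of smaller elements of \<open>X\<close>, is injective
  on \<open>X\<close>.\<close>

lemma card_first_le: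
  fixes X :: "nat set"
  shows "finite {p \<in> X. card {q \<in> X. q < p} < n}" "card {p \<in> X. card {q \<in> X. q < p} < n} \<le> n"
proof -
  let ?B = "{p \<in> X. card {q \<in> X. q < p} < n}"
  let ?r = "\<lambda>p. card {q \<in> X. q < p}"
  have less: "?r p < ?r p'" if "p \<in> X" "p < p'" for p p'
    by (rule psubset_card_mono) (use that in auto)
  have inj: "inj_on ?r ?B"
  proof (rule inj_onI)
    fix x y assume "x \<in> ?B" "y \<in> ?B" "?r x = ?r y"
    then show "x = y" using less[of x y] less[of y x] by (cases x y rule: linorder_cases) auto
  qed
  have img: "?r ` ?B \<subseteq> {..<n}" by auto
  show "finite ?B" using inj_on_finite[OF inj img] by simp
  show "card ?B \<le> n" using card_inj_on_le[OF inj img] by simp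
qed

lemma card_first_ge:
  fixes X :: "nat set"
  assumes "infinite X"
  shows "n \<le> card {p \<in> X. card {q \<in> X. q < p} < n}"
proof -
  have "enumerate X ` {..<n} \<subseteq> {p \<in> X. card {q \<in> X. q < p} < n}"
  proof clarsimp
    fix i assume i: "i < n"
    have "{q \<in> X. q < enumerate X i} \<subseteq> enumerate X ` {..<i}"
    proof clarsimp
      fix q assume "q \<in> X" "q < enumerate X i"
      then obtain j where j: "q = enumerate X j" using enumerate_Ex[of X] assms by metis
      have "j < i" using \<open>q < enumerate X i\<close> j enumerate_mono[of i j X] assms
        by (metis linorder_neqE_nat less_asym less_irrefl)
      then show "q \<in> enumerate X ` {..<i}" using j by blast
    qed
    then have "card {q \<in> X. q < enumerate X i} \<le> i"
      using surj_card_le[of "{..<i}"] by fastforce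
    then show "enumerate X i \<in> X \<and> card {q \<in> X. q < enumerate X i} < n"
      using i enumerate_in_set[OF assms] by simp
  qed
  from card_mono[OF card_first_le(1) this]
  have "card (enumerate X ` {..<n}) \<le> card {p \<in> X. card {q \<in> X. q < p} < n}" .
  moreover have "inj_on (enumerate X) {..<n}"
    using strict_mono_enumerate[OF assms] strict_mono_imp_inj_on by blast
  ultimately show ?thesis by (simp add: card_image)
qed

text \<open>Having infinitely many attained positions, \<open>e\<close> claims at least
  \<open>2 ^ e\<close>. The smaller indices together claim at most the sum of \<open>2 ^ e'\<close>
  over \<open>e' < e\<close>, which is less.\<close>

lemma elected_exists:
  assumes "infinite {p. attained e p}"
  shows "\<exists>P. elected e P \<and> (\<forall>e'<e. \<not> elected e' P)"
proof (rule ccontr)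
  assume neg: "\<not> (\<exists>P. elected e P \<and> (\<forall>e'<e. \<not> elected e' P))"
  let ?X = "\<lambda>e. {p. e \<le> p \<and> attained e p}"
  have el: "{p. elected e p} = {p \<in> ?X e. card {q \<in> ?X e. q < p} < 2 ^ e}" for e
    unfolding elected_def by (auto simp: conj_ac)
  have fin: "finite {p. elected e p}" for e unfolding el by (rule card_first_le(1))
  have "infinite (?X e)"
  proof
    assume "finite (?X e)"
    then have "finite (?X e \<union> {..<e})" by simp
    moreover have "{p. attained e p} \<subseteq> ?X e \<union> {..<e}" by auto
    ultimately show False using assms finite_subset by blast
  qed
  then have "2 ^ e \<le> card {p. elected e p}" unfolding el by (rule card_first_ge)
  also have "\<dots> \<le> card (\<Union>e'<e. {p. elected e' p})"
    by (rule card_mono) (use neg fin in auto)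
  also have "\<dots> \<le> (\<Sum>e'<e. card {p. elected e' p})"
    by (rule card_UN_le) simp
  also have "\<dots> \<le> (\<Sum>e'<e. 2 ^ e')"
    unfolding el by (rule sum_mono) (rule card_first_le(2))
  also have "\<dots> < 2 ^ e" by (induction e) auto
  finally show False by simp
qed

section \<open>The selected pair in the limit\<close>

lemma set_decode_add:
  assumes "set_decode F \<inter> set_decode F' = {}"
  shows "set_decode (F + F') = set_decode F \<union> set_decode F'"
proof -
  have "set_encode (set_decode F \<union> set_decode F') = set_encode (set_decode F) + set_encode (set_decode F')"
    using assms unfolding set_encode_def by (intro sum.union_disjoint) simp_all
  then have "set_encode (set_decode F \<union> set_decode F') = F + F'" by simp
  then show ?thesis by (metis finite_Un finite_set_decode set_encode_inverse)
qed

lemma candidate_disjoint: "candidate p p' F F' \<Longrightarrow> set_decode F \<inter> set_decode F' = {}"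
  unfolding candidate_def using hasbit_less by (auto simp flip: hasbit_iff_set_decode)

text \<open>One \<open>K\<close> bounds the levels of all false codes below \<open>2 * M\<close>.
  The given true pair eventually exceeds \<open>K\<close>, hence so does the maximiser, which is
  therefore true as well.\<close>

lemma selected_limit:
  assumes "candidate p p' F F'" "set_decode F \<subseteq> index_set e" "set_decode F' \<subseteq> index_set e" "p < p'"
  shows "\<forall>\<^sub>F a in sequentially. \<forall>\<^sub>F t in sequentially.
    candidate p p' (selected e p p' a t div code_bound p') (selected e p p' a t mod code_bound p') \<and>
    set_decode (selected e p p' a t div code_bound p') \<subseteq> index_set e \<and> set_decode (selected e p p' a t mod code_bound p') \<subseteq> index_set e"
proof -
  define M where "M = code_bound p'"
  have "code_sum F < 2 ^ Suc p'" "code_sum F' < 2 ^ Suc p'"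
    using assms(1,4) power_increasing[of "Suc p" "Suc p'" "2::nat"]
    unfolding candidate_def top_bit_def by linarith+
  then have FM: "F < M" "F' < M" unfolding M_def code_bound_def by (simp_all only: code_less_if_code_sum)
  have "\<exists>K. \<forall>G<2 * M. \<not> set_decode G \<subseteq> index_set e \<longrightarrow> (\<forall>a. limit_level e G a \<le> K)"
  proof -
    have "\<forall>G. \<exists>K. \<not> set_decode G \<subseteq> index_set e \<longrightarrow> (\<forall>a. limit_level e G a \<le> K)"
      using limit_level_bounded by blast
    then obtain k where "\<forall>G. \<not> set_decode G \<subseteq> index_set e \<longrightarrow> (\<forall>a. limit_level e G a \<le> k G)"
      by (rule choice[THEN exE])
    then have k: "\<And>G a. \<not> set_decode G \<subseteq> index_set e \<Longrightarrow> limit_level e G a \<le> k G" by blast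
    have "limit_level e G a \<le> (\<Sum>G<2 * M. k G)" if "G < 2 * M" "\<not> set_decode G \<subseteq> index_set e" for G a
    proof -
      have "k G \<le> (\<Sum>G<2 * M. k G)" by (rule member_le_sum) (use that in auto)
      then show ?thesis using k[OF that(2), of a] by simp
    qed
    then show ?thesis by blast
  qed
  then obtain K where K: "\<And>G a. G < 2 * M \<Longrightarrow> \<not> set_decode G \<subseteq> index_set e \<Longrightarrow> limit_level e G a \<le> K" by blast
  have "set_decode (F + F') \<subseteq> index_set e" using set_decode_add[OF candidate_disjoint[OF assms(1)]] assms by simp
  then have "\<forall>\<^sub>F a in sequentially. K < limit_level e (F + F') a" by (rule limit_level_unbounded)
  then show ?thesis unfolding M_def[symmetric]
  proof eventually_elim
    case a: (elim a)
    show ?case using stage_level_limit_finite[of "2 * M" e a]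
    proof eventually_elim
      case t: (elim t)
      define c where "c = (\<lambda>Q. candidate p p' (Q div M) (Q mod M))"
      define l where "l = (\<lambda>Q. stage_level e (Q div M + Q mod M) a t)"
      let ?S = "{Q. Q < M * M \<and> c Q}"
      define Q where "Q = selected e p p' a t"
      define Q0 where "Q0 = F * M + F'"
      have M0: "0 < M" using FM by simp
      have Q0: "Q0 div M = F" "Q0 mod M = F'" using FM by (simp_all add: Q0_def)
      have "Q0 < M * M"
      proof -
        have "Q0 < Suc F * M" using FM by (simp add: Q0_def)
        also have "\<dots> \<le> M * M" using FM by (intro mult_le_mono1) simp
        finally show ?thesis .
      qed
      then have Q0S: "Q0 \<in> ?S" using assms(1) by (simp add: c_def Q0)
      have "finite (l ` ?S)" by simp
      then have "Max (l ` ?S) \<in> l ` ?S" using Q0S by (intro Max_in) auto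
      \<comment> \<open>A maximiser exists, so the search in \<open>selected\<close> succeeds and
        does not return its default value.\<close>
      then obtain Q1 where Q1: "Q1 \<in> ?S" "l Q1 = Max (l ` ?S)" by auto
      have "\<forall>Q'<M * M. c Q' \<longrightarrow> l Q' \<le> l Q1" unfolding Q1(2) by (auto intro: Max_ge)
      then have "Q < M * M \<and> (c Q \<and> (\<forall>Q'<M * M. c Q' \<longrightarrow> l Q' \<le> l Q))"
        unfolding Q_def selected_def M_def[symmetric] c_def[symmetric] l_def[symmetric]
        using Q1(1) bleast_works[of Q1 "M * M" "\<lambda>Q. c Q \<and> (\<forall>Q'<M * M. c Q' \<longrightarrow> l Q' \<le> l Q)"]
        unfolding c_def l_def by simp
      then have Q: "Q < M * M" "c Q" "l Q0 \<le> l Q" using Q0S by auto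
      have "Q div M < M" "Q mod M < M" using Q(1) M0 by (simp_all add: less_mult_imp_div_less)
      then have G: "Q div M + Q mod M < 2 * M" "F + F' < 2 * M" using FM by linarith+
      have "K < limit_level e (Q div M + Q mod M) a"
        using Q(3) t G a unfolding l_def Q0 by simp
      then have "set_decode (Q div M + Q mod M) \<subseteq> index_set e" using K[OF G(1)] by (meson not_le)
      then show ?case using Q(2) set_decode_add[OF candidate_disjoint] unfolding c_def Q_def by auto
    qed
  qed
qed

section \<open>No solution is a \<open>\<Pi>\<^sup>0\<^sub>3\<close> set\<close>

lemma FS_add:
  assumes "x \<in> FS B" "y \<in> FS C" "B \<inter> C = {}"
  shows "x + y \<in> FS (B \<union> C)"
proof -
  obtain F G where "x = \<Sum>F" "F \<subseteq> B" "finite F" "F \<noteq> {}" "y = \<Sum>G" "G \<subseteq> C" "finite G" "G \<noteq> {}"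
    using assms unfolding FS_def by blast
  moreover from this have "\<Sum>(F \<union> G) = x + y"
    using assms(3) by (simp, intro sum.union_disjoint) auto
  ultimately show ?thesis unfolding FS_def by (intro CollectI exI[of _ "F \<union> G"]) auto
qed

lemma FS_mono: "B \<subseteq> C \<Longrightarrow> FS B \<subseteq> FS C"
  unfolding FS_def by blast

lemma sum_in_FS: "finite F \<Longrightarrow> 0 < \<Sum>F \<Longrightarrow> \<Sum>F \<in> FS F" for F :: "nat set"
  unfolding FS_def by (intro CollectI exI[of _ F]) auto

text \<open>By the pigeonhole principle infinitely many elements share a residue modulo
  \<open>2 ^ s\<close>; any \<open>2 ^ s\<close> of them have a sum divisible by
  \<open>2 ^ s\<close>.\<close>

lemma divisible_sum_exists:
  fixes A :: "nat set"
  assumes "infinite A"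
  shows "\<exists>F\<subseteq>A. finite F \<and> F \<noteq> {} \<and> (\<forall>f\<in>F. N \<le> f) \<and> 2 ^ s dvd \<Sum>F"
proof -
  let ?B = "A - {..<N}"
  have "infinite ?B" using assms by simp
  moreover have "finite ((\<lambda>x. x mod 2 ^ s) ` ?B)"
    by (rule finite_subset[of _ "{..<2 ^ s}"]) auto
  ultimately obtain y where y: "infinite {x \<in> ?B. x mod 2 ^ s = y mod 2 ^ s}"
    using pigeonhole_infinite[of ?B "\<lambda>x. x mod 2 ^ s"] by blast
  obtain F where F: "F \<subseteq> {x \<in> ?B. x mod 2 ^ s = y mod 2 ^ s}" "finite F" "card F = 2 ^ s"
    using infinite_arbitrarily_large[OF y] by blast
  have "(\<Sum>F) mod 2 ^ s = (\<Sum>x\<in>F. x mod 2 ^ s) mod 2 ^ s" by (simp add: mod_sum_eq)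
  also have "(\<Sum>x\<in>F. x mod 2 ^ s) = (\<Sum>x\<in>F. y mod 2 ^ s)" using F(1) by (intro sum.cong) auto
  also have "\<dots> mod 2 ^ s = 0" using F(3) by simp
  finally have "2 ^ s dvd \<Sum>F" by (simp add: dvd_eq_mod_eq_0)
  moreover have "F \<noteq> {}" using F(3) by auto
  ultimately show ?thesis using F(1,2) by (intro exI[of _ F]) auto
qed

lemma lowest_bit_exists:
  assumes "0 < k"
  shows "\<exists>\<tau>. hasbit \<tau> k \<and> 2 ^ \<tau> dvd k"
proof -
  define \<tau> where "\<tau> = (LEAST j. hasbit j k)"
  obtain a where "top_bit a k" using top_bit_exists assms by blast
  then have \<tau>: "hasbit \<tau> k" unfolding \<tau>_def using top_bit_hasbit by (metis LeastI)
  have "2 ^ j dvd k" if "j \<le> \<tau>" for j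
    using that
  proof (induction j)
    case (Suc j)
    then obtain q where q: "k = 2 ^ j * q" by auto
    have "\<not> hasbit j k" using Suc.prems not_less_Least[of j "\<lambda>j. hasbit j k"] by (simp add: \<tau>_def)
    then have "even q" by (simp add: hasbit_def q)
    then show ?case using q by auto
  qed simp
  with \<tau> show ?thesis by blast
qed

lemma eventually_sequentiallyD: "eventually P sequentially \<Longrightarrow> \<exists>N. \<forall>n\<ge>N. P n"
  by (simp add: eventually_sequentially)

text \<open>The positions \<open>P\<close>, \<open>p'\<close>, \<open>a\<close>,
  \<open>\<tau>\<close> are fixed in this order, each of the last three beyond the threshold of the
  corresponding limit. \<open>F0\<close> and \<open>G1\<close> only show that a true candidate
  exists; the pair \<open>m\<close>, \<open>m'\<close> is the one selected at stage
  \<open>\<tau>\<close>.\<close>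

lemma no_solution:
  assumes "infinite A" "Pi03 A" "\<And>x. x \<in> FS A \<Longrightarrow> coloring x = \<gamma>"
  shows False
proof -
  obtain R where R: "recursive_rel4 R" "\<And>n. n \<in> A \<longleftrightarrow> (\<forall>x. \<exists>y. \<forall>z. R n x y z)"
    using assms(2) unfolding Pi03_def by blast
  obtain e0 where e0: "\<And>n x y. (\<forall>z. R n x y z) \<longleftrightarrow> (\<forall>t. unrefuted e0 n x y t)"
    using unrefuted_universal[OF R(1)] by blast
  obtain f0 where f0: "f0 \<in> A" using assms(1) by (metis all_not_in_conv finite.emptyI)
  have "coloring f0 = \<gamma>" by (rule assms(3)) (use f0 in \<open>auto simp: FS_def intro!: exI[of _ "{f0}"]\<close>)
  then have \<gamma>: "\<gamma> < 2" unfolding coloring_def by auto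
  \<comment> \<open>As \<open>\<gamma> < 2\<close>, \<open>e div 2\<close> is the program of the set
    and the parity of \<open>e\<close> is that of its colour.\<close>
  define e where "e = 2 * e0 + \<gamma>"
  have index_set: "index_set e = A"
    using R(2) e0 \<gamma> by (auto simp: index_set_def e_def)
  have dec: "set_decode (set_encode F) = F" "code_sum (set_encode F) = \<Sum>F" if "finite F" for F
    using that by (simp_all add: code_sum_eq)

  have "infinite {p. attained e p}"
    unfolding infinite_nat_iff_unbounded_le
  proof
    fix N
    have "infinite (A - {..<2 ^ N})" using assms(1) by simp
    then obtain f where f: "f \<in> A" "2 ^ N \<le> f"
      by (metis DiffE all_not_in_conv finite.emptyI lessThan_iff not_less)
    then obtain p where p: "top_bit p f" using top_bit_exists[of f] by (auto simp: less_le_trans[OF _ f(2)])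
    have "attained e p" unfolding attained_def index_set
      using p f(1) dec[of "{f}"] by (intro exI[of _ "set_encode {f}"]) auto
    then show "\<exists>p\<ge>N. p \<in> {p. attained e p}" using top_bit_ge[OF p f(2)] by blast
  qed
  then obtain P where P: "elected e P" "\<And>e'. e' < e \<Longrightarrow> \<not> elected e' P"
    using elected_exists by blast
  then obtain F0 where F0: "top_bit P (code_sum F0)" "set_decode F0 \<subseteq> A"
    unfolding elected_def attained_def index_set by blast
  obtain p0 where p0: "\<forall>p'\<ge>p0. \<forall>\<^sub>F a in sequentially. \<forall>\<^sub>F t in sequentially. served P p' a t = e"
    using eventually_sequentiallyD[OF served_limit[OF P]] ..

  \<comment> \<open>The size of its elements keeps \<open>G1\<close> disjoint from \<open>F0\<close>
    and pushes the top bit of its sum past \<open>p0\<close> and \<open>P\<close>.\<close>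
  obtain G1 where G1: "G1 \<subseteq> A" "finite G1" "G1 \<noteq> {}" "\<forall>f\<in>G1. 2 ^ (p0 + Suc P) \<le> f" "2 ^ Suc P dvd \<Sum>G1"
    using divisible_sum_exists[OF assms(1), of "2 ^ (p0 + Suc P)" "Suc P"] by blast
  have sum_ge: "n \<le> \<Sum>G" if G: "finite G" "G \<noteq> {}" "\<forall>f\<in>G. n \<le> f" for G and n :: nat
  proof -
    obtain f where "f \<in> G" using G(2) by blast
    then show ?thesis using G member_le_sum[of f G "\<lambda>x. x"] by fastforce
  qed
  have G1_ge: "2 ^ (p0 + Suc P) \<le> \<Sum>G1" using sum_ge G1 by blast
  then have "0 < \<Sum>G1" by (rule less_le_trans[rotated]) simp
  then obtain p' where p': "top_bit p' (\<Sum>G1)" using top_bit_exists by blast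
  have p'_ge: "p0 \<le> p'" "P < p'" using top_bit_ge[OF p' G1_ge] by simp_all
  have "candidate P p' F0 (set_encode G1)"
  proof -
    have "f \<notin> G1" if "f \<in> set_decode F0" for f
    proof
      assume "f \<in> G1"
      then have "2 ^ (p0 + Suc P) \<le> f" using G1(4) by blast
      moreover have "(2::nat) ^ Suc P \<le> 2 ^ (p0 + Suc P)" by (intro power_increasing) simp_all
      moreover have "f < 2 ^ Suc P" using le_code_sum[OF that] F0(1) unfolding top_bit_def by simp
      ultimately show False by linarith
    qed
    then show ?thesis unfolding candidate_def hasbit_iff_set_decode using F0 G1 p' dec[OF G1(2)] by auto
  qed
  from selected_limit[OF this _ _ p'_ge(2), of e]
  have "\<forall>\<^sub>F a in sequentially. \<forall>\<^sub>F t in sequentially.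
    candidate P p' (selected e P p' a t div code_bound p') (selected e P p' a t mod code_bound p') \<and>
    set_decode (selected e P p' a t div code_bound p') \<subseteq> A \<and> set_decode (selected e P p' a t mod code_bound p') \<subseteq> A"
    using F0(2) G1(1,2) by (simp add: index_set)
  then have "\<forall>\<^sub>F a in sequentially. \<forall>\<^sub>F t in sequentially.
    served P p' a t = e \<and> candidate P p' (selected_low P p' a t) (selected_high P p' a t) \<and>
    set_decode (selected_low P p' a t) \<subseteq> A \<and> set_decode (selected_high P p' a t) \<subseteq> A"
    using p0[rule_format, OF p'_ge(1)]
  proof eventually_elim
    case (elim a)
    then show ?case by eventually_elim (simp add: selected_low_def selected_high_def)
  qed
  from eventually_sequentiallyD[OF this] obtain a0 where a0: "\<forall>a\<ge>a0. \<forall>\<^sub>F t in sequentially.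
    served P p' a t = e \<and> candidate P p' (selected_low P p' a t) (selected_high P p' a t) \<and>
    set_decode (selected_low P p' a t) \<subseteq> A \<and> set_decode (selected_high P p' a t) \<subseteq> A"
    ..

  obtain G2 where G2: "G2 \<subseteq> A" "finite G2" "G2 \<noteq> {}" "\<forall>f\<in>G2. 2 ^ (a0 + Suc p') \<le> f" "2 ^ Suc p' dvd \<Sum>G2"
    using divisible_sum_exists[OF assms(1), of "2 ^ (a0 + Suc p')" "Suc p'"] by blast
  define m'' where "m'' = \<Sum>G2"
  have m''_ge: "2 ^ (a0 + Suc p') \<le> m''" unfolding m''_def using sum_ge G2 by blast
  then have m''_pos: "0 < m''" by (rule less_le_trans[rotated]) simp
  then obtain a where a: "top_bit a m''" using top_bit_exists by blast
  have a_ge: "a0 \<le> a" "p' < a" using top_bit_ge[OF a m''_ge] by simp_all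
  obtain t0 where t0: "\<forall>t\<ge>t0.
    served P p' a t = e \<and> candidate P p' (selected_low P p' a t) (selected_high P p' a t) \<and>
    set_decode (selected_low P p' a t) \<subseteq> A \<and> set_decode (selected_high P p' a t) \<subseteq> A"
    using eventually_sequentiallyD[OF a0[rule_format, OF a_ge(1)]] ..

  \<comment> \<open>Divisibility pushes the lowest bit of the sum past \<open>t0\<close> and
    \<open>a\<close>; the size of the elements keeps \<open>G3\<close> disjoint from the other three
    sets.\<close>
  obtain G3 where G3: "G3 \<subseteq> A" "finite G3" "G3 \<noteq> {}" "\<forall>f\<in>G3. 2 ^ Suc a \<le> f" "2 ^ (t0 + Suc a) dvd \<Sum>G3"
    using divisible_sum_exists[OF assms(1), of "2 ^ Suc a" "t0 + Suc a"] by blast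
  define k where "k = \<Sum>G3"
  have "2 ^ Suc a \<le> k" unfolding k_def using sum_ge G3 by blast
  then have k_pos: "0 < k" by (rule less_le_trans[rotated]) simp
  then obtain \<tau> where \<tau>: "hasbit \<tau> k" "2 ^ \<tau> dvd k" using lowest_bit_exists by blast
  have "t0 + Suc a \<le> \<tau>" using hasbit_ge[OF \<tau>(1)] G3(5) unfolding k_def by blast
  then have \<tau>_ge: "t0 \<le> \<tau>" "a < \<tau>" by simp_all

  define F1 where "F1 = selected_low P p' a \<tau>"
  define F2 where "F2 = selected_high P p' a \<tau>"
  have served: "served P p' a \<tau> = e" and candidate: "candidate P p' F1 F2"
    and sub: "set_decode F1 \<subseteq> A" "set_decode F2 \<subseteq> A"
    using t0[rule_format, OF \<tau>_ge(1)] unfolding F1_def F2_def by simp_all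
  define m where "m = code_sum F1"
  define m' where "m' = code_sum F2"
  have m: "top_bit P m" "top_bit p' m'" "2 ^ Suc P dvd m'"
    using candidate unfolding candidate_def m_def m'_def by simp_all
  have m_lt: "m < 2 ^ Suc P" using m(1) unfolding top_bit_def by simp
  have mm'_lt: "m + m' < 2 ^ Suc p'" using top_bit_add[OF m_lt m(3,2)] unfolding top_bit_def by simp
  have m''_dvd: "2 ^ Suc p' dvd m''" unfolding m''_def by (rule G2(5))
  have mm_lt: "m + m' + m'' < 2 ^ Suc a" using top_bit_add[OF mm'_lt m''_dvd a] unfolding top_bit_def by simp
  have k_dvd: "2 ^ Suc a dvd k" using G3(5) unfolding k_def by (meson dvd_trans le_add2 le_imp_power_dvd)

  have G2_ge: "2 ^ Suc p' \<le> f" if "f \<in> G2" for f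
  proof -
    have "(2::nat) ^ Suc p' \<le> 2 ^ (a0 + Suc p')" by (intro power_increasing) simp_all
    then show ?thesis using G2(4) that order_trans by blast
  qed
  have F_lt: "f < 2 ^ Suc p'" if "f \<in> set_decode F1 \<union> set_decode F2" for f
    using that le_code_sum[of f F1] le_code_sum[of f F2] mm'_lt unfolding m_def m'_def by auto
  have pos: "0 < m" "0 < m'" using m unfolding top_bit_def
    by (auto intro: less_le_trans[rotated])
  have in1: "m \<in> FS (set_decode F1)" "m' \<in> FS (set_decode F2)" "m'' \<in> FS G2" "k \<in> FS G3"
    using pos m''_pos k_pos unfolding m_def m'_def m''_def k_def code_sum_eq
    by (auto intro!: sum_in_FS simp: G2(2) G3(2))
  have d12: "set_decode F1 \<inter> set_decode F2 = {}" using candidate_disjoint[OF candidate] .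
  have d3: "(set_decode F1 \<union> set_decode F2) \<inter> G2 = {}" using F_lt G2_ge by fastforce
  have G3_gt: "f < 2 ^ Suc a" if "f \<in> set_decode F1 \<union> set_decode F2 \<union> G2" for f
  proof -
    have "f \<le> m + m' + m''"
      using that le_code_sum[of f F1] le_code_sum[of f F2] member_le_sum[of f G2 "\<lambda>x. x"] G2(2)
      unfolding m_def m'_def m''_def by auto
    then show ?thesis using mm_lt by simp
  qed
  have d4: "(set_decode F1 \<union> set_decode F2 \<union> G2) \<inter> G3 = {}" using G3_gt G3(4) by fastforce
  have FSA: "x \<in> FS A" if "x \<in> FS B" "B \<subseteq> set_decode F1 \<union> set_decode F2 \<union> G2 \<union> G3" for x B
    using FS_mono[of B A] that sub G2(1) G3(1) by blast
  let ?B = "set_decode F1 \<union> set_decode F2 \<union> G2"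
  have in2: "m + m' \<in> FS (set_decode F1 \<union> set_decode F2)" using FS_add[OF in1(1,2) d12] .
  have in3: "m + m'' \<in> FS (set_decode F1 \<union> G2)" "m' + m'' \<in> FS (set_decode F2 \<union> G2)"
    "m + m' + m'' \<in> FS (set_decode F1 \<union> set_decode F2 \<union> G2)"
    using FS_add in1 in2 d3 by (simp_all add: Int_Un_distrib2)
  have all: "x \<in> FS ?B" if "x \<in> {m, m', m + m', m'', m + m'', m' + m'', m + m' + m''}" for x
    using that in1(1-3) in2 in3 FS_mono[of _ ?B] by blast
  have colx: "coloring x = \<gamma>" if "x \<in> {m, m', m + m', m'', m + m'', m' + m'', m + m' + m''}" for x
    using FSA[OF all[OF that]] assms(3) by blast
  have colk: "coloring (x + k) = \<gamma>" if "x \<in> {m, m', m + m', m'', m + m'', m' + m'', m + m' + m''}" for x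
    using FSA[OF FS_add[OF all[OF that] in1(4) d4]] assms(3) by blast
  have "coloring k = \<gamma>" using FSA[OF in1(4)] assms(3) by blast
  \<comment> \<open>The second cube has only seven terms of colour \<open>\<gamma>\<close>, because
    its vertex 0 has colour 0 by \<open>coloring_0\<close>.\<close>
  then have "cube m m' m'' (\<lambda>x. coloring (x + k)) = 8 * \<gamma>" "cube m m' m'' coloring = 7 * \<gamma>"
    unfolding cube_def using colx colk by simp_all
  then have "even (\<gamma> + defect (table \<tau> (\<tau> ^ 3)) \<tau> a m m')"
    using even_defect[OF m_lt m(3) mm'_lt m''_dvd mm_lt a \<tau>_ge(2) k_dvd \<tau>] by blast
  moreover have "odd (e + defect (table \<tau> (\<tau> ^ 3)) \<tau> a m m')"
    using odd_defect[OF p'_ge(2) a_ge(2) \<tau>_ge(2) m] served unfolding m_def m'_def F1_def F2_def by simp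
  ultimately show False by (simp add: e_def)
qed

theorem theorem4p3:
  shows "\<exists>c. recursive1 c \<and> (\<forall>n. c n < 8) \<and>
           (\<forall>A. infinite A \<and> Pi03 A \<longrightarrow> \<not> hindman_solution c A)"
proof (intro exI[of _ coloring] conjI allI impI notI)
  show "recursive1 coloring" by (rule recursive1_coloring)
  \<comment> \<open>Numbers below 8 stand for the elements of \<open>{0,1}^3\<close>.\<close>
  show "coloring n < 8" for n
  proof -
    have "coloring n < 2" unfolding coloring_def by simp
    then show ?thesis by simp
  qed
  fix A assume "infinite A \<and> Pi03 A" "hindman_solution coloring A"
  then show False using no_solution unfolding hindman_solution_def by blast
qed

end
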